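(* Let $d\ge 1$, $E \subseteq \mathbb{Z}^d$, and let $q^X, q^Y$ be two rate matrices on $E$ (transition-rate matrices $E\times E\to\mathbb{R}$ with non-negative off-diagonal entries and finite diagonal entries, i.e. no instantaneous states). Extend them to functions $\bar{q}^X, \bar{q}^Y$ on $E \times \mathbb{Z}^d$ by setting $\bar q^X=q^X$, $\bar q^Y=q^Y$ on $E\times E$ and $\bar q^X=\bar q^Y=0$ on $E \times (\mathbb{Z}^d \setminus E)$. Let $\rho \subseteq E \times E$ be a binary relation on $E$ such that for every $(x,y) \in \rho$ and every $\xi \in \mathbb{Z}^d$: (a) if $(x+\xi,y) \notin \rho$ then $\bar{q}^X(x,x+\xi) \leq \bar{q}^Y(y,y+\xi)$; (b) if $(x,y+\xi) \notin \rho$ then $\bar{q}^X(x,x+\xi) \geq \bar{q}^Y(y,y+\xi)$; (c) if $(x+\xi,y+\xi) \notin \rho$ then $(x+\xi,y+\xi) \notin E \times E$. Then for every pair of initial conditions $(x^0, y^0) \in \rho$ there exist two continuous-time Markov chains $X$ and $Y$ defined on the same probability space, both with state space $E$, with transition rates $q^X$ and $q^Y$ respectively, such that $X(0) = x^0$, $Y(0) = y^0$ and $$\mathbb{P}\big((X(t),Y(t)) \in \rho \text{ for all } t \in [0, \tau^X \wedge \tau^Y)\big) = 1.$$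
   Context: A binary relation on $E$ is any subset of $E\times E$. For a càdlàg process $Z$ with values in $E\subseteq\mathbb{Z}^d$, its explosion time is $\tau^Z = \inf\{t \geq 0 : \text{for every finite } \Gamma \subseteq E \text{ there exists } s < t \text{ with } Z(s) \notin \Gamma\}$. The chains may be explosive; $a\wedge b$ denotes the minimum. *)

theory Defs
  imports "HOL-Probability.Probability"
begin

text \<open>Sites of the lattice Z^d are vectors @ int ^ 'd, 'd a finite (hence nonempty) index type.\<close>

definition rate_matrix :: "'a set \<Rightarrow> ('a \<Rightarrow> 'a \<Rightarrow> real) \<Rightarrow> bool" where
  "rate_matrix E q \<longleftrightarrow>
     (\<forall>x\<in>E. \<forall>y\<in>E. x \<noteq> y \<longrightarrow> 0 \<le> q x y) \<and>
     (\<forall>x\<in>E. ((\<lambda>y. q x y) has_sum (0::real)) E)"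

definition qbar :: "'a set \<Rightarrow> ('a \<Rightarrow> 'a \<Rightarrow> real) \<Rightarrow> 'a \<Rightarrow> 'a \<Rightarrow> real" where
  "qbar E q x z = (if z \<in> E then q x z else 0)"

definition hold_rate :: "('a \<Rightarrow> 'a \<Rightarrow> real) \<Rightarrow> 'a \<Rightarrow> real" where
  "hold_rate q x = - q x x"

definition jump_prob :: "('a \<Rightarrow> 'a \<Rightarrow> real) \<Rightarrow> 'a \<Rightarrow> 'a \<Rightarrow> real" where
  "jump_prob q x y =
     (if hold_rate q x = 0 then (if y = x then 1 else 0)
      else (if y = x then 0 else q x y / hold_rate q x))"

text \<open>X is a continuous-time Markov chain on M with state space E, rate matrix q,
  started at x0 (jump chain / holding time description, Norris Sect. 2.6).
  Z n is the n-th state of the jump chain, S n the (possibly infinite) holding time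
  in Z n; X coincides with Z n on [J_n, J_(n+1)), J_n = sum of S k for k < n, up to the
  explosion time sum of all S n; after that X is an arbitrary E-valued process.\<close>
definition ctmc ::
  "'m measure \<Rightarrow> 'a set \<Rightarrow> ('a \<Rightarrow> 'a \<Rightarrow> real) \<Rightarrow> 'a \<Rightarrow> (real \<Rightarrow> 'm \<Rightarrow> 'a) \<Rightarrow> bool" where
  "ctmc M E q x0 X \<longleftrightarrow>
     (\<forall>t. X t \<in> measurable M (count_space UNIV)) \<and>
     (\<forall>t. \<forall>\<omega>\<in>space M. X t \<omega> \<in> E) \<and>
     (\<exists>(Z :: nat \<Rightarrow> 'm \<Rightarrow> 'a) (S :: nat \<Rightarrow> 'm \<Rightarrow> ennreal).
        (\<forall>n. Z n \<in> measurable M (count_space UNIV)) \<and>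
        (\<forall>n. S n \<in> borel_measurable M) \<and>
        (\<forall>n. \<forall>\<omega>\<in>space M. Z n \<omega> \<in> E) \<and>
        (\<forall>(n::nat) (z :: nat \<Rightarrow> 'a) (t :: nat \<Rightarrow> real).
           (\<forall>k\<le>n. z k \<in> E) \<longrightarrow> (\<forall>k<n. 0 \<le> t k) \<longrightarrow>
           measure M {\<omega>\<in>space M. (\<forall>k\<le>n. Z k \<omega> = z k) \<and> (\<forall>k<n. ennreal (t k) < S k \<omega>)}
             = (if z 0 = x0 then 1 else 0) *
               (\<Prod>k<n. exp (- hold_rate q (z k) * t k) * jump_prob q (z k) (z (Suc k)))) \<and>
        (\<forall>\<omega>\<in>space M. \<forall>(n::nat) (t::real). 0 \<le> t \<longrightarrow>
           (\<Sum>k<n. S k \<omega>) \<le> ennreal t \<longrightarrow> ennreal t < (\<Sum>k<Suc n. S k \<omega>) \<longrightarrow>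
           X t \<omega> = Z n \<omega>))"

definition explosion_time :: "(real \<Rightarrow> 'a) \<Rightarrow> ereal" where
  "explosion_time x =
     Inf {ereal t | t. 0 \<le> t \<and> (\<forall>\<Gamma>. finite \<Gamma> \<longrightarrow> (\<exists>s. 0 \<le> s \<and> s < t \<and> x s \<notin> \<Gamma>))}"

end

theory Submission
  imports Defs
begin

text \<open>
  From \<open>(x, y)\<close> in \<open>\<rho>\<close>, let both components jump by \<open>\<xi>\<close> at rate \<open>min (qX x (x+\<xi>)) (qY y (y+\<xi>))\<close> and let
  the component with the larger rate jump alone at the excess rate. Conditions (a), (b), (c)
  ensure that this pair never leaves \<open>\<rho>\<close>. Each component is Markov with the right rates: by
  memorylessness of the exponential law, one step of the pair followed by an independent chain of
  rate \<open>q\<close> is again a chain of rate \<open>q\<close>, hence so are \<open>N\<close> steps of the pair followed by an independent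
  chain, and one lets \<open>N\<close> tend to infinity. In the limit the independent chain only matters when the
  pair explodes while the component in question has not.

  The pair is run with total rate \<open>hold_rate qX x + hold_rate qY y + 1\<close>, allowing null steps. Since
  the unit-rate waiting times almost surely have infinite sum, the pair can explode only by visiting
  infinitely many states; then one of the two components leaves every finite set, so that the minimum
  of the explosion times is at most the explosion time of the pair.
\<close>

section \<open>Sampling from sequences of uniform variables\<close>

definition unif :: "real measure" where
  "unif = restrict_space lborel {0<..<1}"

definition expo :: "real measure" where
  "expo = density lborel (exponential_density 1)"

lemma prob_space_unif: "prob_space unif"
  unfolding unif_def
  by (auto simp: space_restrict_space emeasure_restrict_space intro!: prob_spaceI)

lemma prob_space_expo: "prob_space expo"
  unfolding expo_def by (rule prob_space_exponential_density) simp

lemma sets_expo [measurable_cong, simp]: "sets expo = sets borel"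
  by (simp add: expo_def)

lemma AE_expo_pos: "AE e in expo. 0 < e"
proof -
  have "AE x in lborel. x \<noteq> (0::real)"
    by (rule AE_lborel_singleton)
  then show ?thesis
    unfolding expo_def
    by (subst AE_density) (auto simp: exponential_density_def)
qed

lemma nn_integral_expo:
  assumes [measurable]: "f \<in> borel_measurable borel"
  shows "(\<integral>\<^sup>+e. f e \<partial>expo) = (\<integral>\<^sup>+e. ennreal (exp (- e)) * f e * indicator {0..} e \<partial>lborel)"
proof -
  have "(\<integral>\<^sup>+e. f e \<partial>expo) = (\<integral>\<^sup>+e. ennreal (exponential_density 1 e) * f e \<partial>lborel)"
    unfolding expo_def by (rule nn_integral_density) auto
  also have "\<dots> = (\<integral>\<^sup>+e. ennreal (exp (- e)) * f e * indicator {0..} e \<partial>lborel)"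
    by (intro nn_integral_cong) (auto simp: exponential_density_def indicator_def)
  finally show ?thesis .
qed

lemma nn_integral_exp_interval:
  fixes b :: real
  assumes "u \<le> v" "b \<noteq> 0"
  shows "(\<integral>\<^sup>+e. ennreal (exp (b * e)) * indicator {u..v} e \<partial>lborel) =
    ennreal ((exp (b * v) - exp (b * u)) / b)"
proof -
  have "(\<integral>\<^sup>+e. ennreal (exp (b * e)) * indicator {u..v} e \<partial>lborel) =
    ennreal (exp (b * v) / b - exp (b * u) / b)"
    using assms
    by (intro nn_integral_FTC_Icc) (auto intro!: derivative_eq_intros)
  then show ?thesis by (simp add: diff_divide_distrib)
qed

lemma nn_integral_exp_atLeast:
  "(\<integral>\<^sup>+e. ennreal (exp (- e)) * indicator {u..} e \<partial>lborel) = ennreal (exp (- u))" for u :: real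
proof -
  have "((\<lambda>x::real. - exp (- x)) \<longlongrightarrow> - 0) at_top"
    by (intro tendsto_minus filterlim_compose[OF exp_at_bot] filterlim_uminus_at_bot_at_top)
  then have "(\<integral>\<^sup>+e. ennreal (exp (- e)) * indicator {u..} e \<partial>lborel) = ennreal (0 - (- exp (- u)))"
    by (intro nn_integral_FTC_atLeast) (auto intro!: derivative_eq_intros)
  then show ?thesis by simp
qed

lemma nn_integral_expo_greater:
  assumes "0 \<le> l"
  shows "(\<integral>\<^sup>+e. indicator {e. l * t < e} e \<partial>expo) = ennreal (exp (- (l * max 0 t)))"
proof -
  have "(\<integral>\<^sup>+e. indicator {e. l * t < e} e \<partial>expo) =
      (\<integral>\<^sup>+e. ennreal (exp (- e)) * indicator {l * max 0 t..} e \<partial>lborel)"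
  proof (subst nn_integral_expo, measurable, intro nn_integral_cong_AE)
    have *: "(l * t < x \<and> 0 \<le> x) = (l * max 0 t \<le> x)" if "x \<noteq> l * t" "x \<noteq> 0" for x
    proof (cases "0 \<le> t")
      case True
      then have "0 \<le> l * t" using assms by simp
      then show ?thesis using True that by (auto simp: max_def)
    next
      case False
      then have "l * t \<le> 0" using assms by (simp add: mult_nonneg_nonpos)
      then show ?thesis using False that by (auto simp: max_def)
    qed
    show "AE x in lborel. ennreal (exp (- x)) * indicator {e. l * t < e} x * indicator {0..} x =
            ennreal (exp (- x)) * indicator {l * max 0 t..} x"
      using AE_lborel_singleton[of "l * t"] AE_lborel_singleton[of 0]
      by eventually_elim (use * in \<open>auto simp: indicator_def\<close>)
  qed
  then show ?thesis by (simp add: nn_integral_exp_atLeast)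
qed

lemma nn_integral_expo_exp_max:
  assumes "0 \<le> a" "a < 1" "0 \<le> \<tau>"
  shows "(\<integral>\<^sup>+e. ennreal (exp (- (a * max 0 (\<tau> - e)))) \<partial>expo) =
    ennreal ((exp (- (a * \<tau>)) - a * exp (- \<tau>)) / (1 - a))"
proof -
  have "(\<integral>\<^sup>+e. ennreal (exp (- (a * max 0 (\<tau> - e)))) \<partial>expo) =
    (\<integral>\<^sup>+e. ennreal (exp (- (a * \<tau>))) * (ennreal (exp ((a - 1) * e)) * indicator {0..\<tau>} e) +
        ennreal (exp (- e)) * indicator {\<tau>..} e \<partial>lborel)"
  proof (subst nn_integral_expo, measurable, intro nn_integral_cong_AE)
    show "AE x in lborel. ennreal (exp (- x)) * ennreal (exp (- (a * max 0 (\<tau> - x)))) * indicator {0..} x =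
        ennreal (exp (- (a * \<tau>))) * (ennreal (exp ((a - 1) * x)) * indicator {0..\<tau>} x) +
        ennreal (exp (- x)) * indicator {\<tau>..} x"
      using AE_lborel_singleton[of \<tau>]
      by eventually_elim
        (use assms in \<open>auto simp: indicator_def max_def ennreal_mult[symmetric] exp_add[symmetric] algebra_simps\<close>)
  qed
  also have "\<dots> = ennreal (exp (- (a * \<tau>))) * ennreal ((exp ((a - 1) * \<tau>) - 1) / (a - 1)) + ennreal (exp (- \<tau>))"
    using assms nn_integral_exp_interval[of 0 \<tau> "a - 1"]
    by (simp add: nn_integral_add nn_integral_cmult nn_integral_exp_atLeast)
  also have "\<dots> = ennreal (exp (- (a * \<tau>)) * ((exp ((a - 1) * \<tau>) - 1) / (a - 1)) + exp (- \<tau>))"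
  proof -
    have "0 \<le> (exp ((a - 1) * \<tau>) - 1) / (a - 1)"
      using assms by (intro divide_nonpos_neg) (auto intro: mult_nonpos_nonneg)
    then show ?thesis
      by (simp add: ennreal_mult del: times_divide_eq_right)
  qed
  also have "exp (- (a * \<tau>)) * ((exp ((a - 1) * \<tau>) - 1) / (a - 1)) + exp (- \<tau>) =
     (exp (- (a * \<tau>)) - a * exp (- \<tau>)) / (1 - a)"
  proof -
    have "exp (- (a * \<tau>)) * exp ((a - 1) * \<tau>) = exp (- \<tau>)"
      by (simp add: exp_add[symmetric] algebra_simps)
    then have "exp (- (a * \<tau>)) * ((exp ((a - 1) * \<tau>) - 1) / (a - 1)) = (exp (- \<tau>) - exp (- (a * \<tau>))) / (a - 1)"
      by (simp add: right_diff_distrib)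
    then show ?thesis using assms by (simp add: divide_simps) (simp add: algebra_simps)
  qed
  finally show ?thesis .
qed

lemma nn_integral_expo_exp: "(\<integral>\<^sup>+e. ennreal (exp (- e)) \<partial>expo) = ennreal (1 / 2)"
proof -
  have "(\<integral>\<^sup>+e. ennreal (exp (- e)) \<partial>expo) =
    (\<integral>\<^sup>+e. ennreal (exp (- 2 * e)) * indicator {0..} e \<partial>lborel)"
    by (subst nn_integral_expo)
      (auto intro!: nn_integral_cong simp: ennreal_mult[symmetric] exp_add[symmetric])
  also have "\<dots> = ennreal (0 - (- (exp (- 2 * 0) / 2)))"
  proof (rule nn_integral_FTC_atLeast)
    have "((\<lambda>x::real. - (exp (- x) / 2)) \<longlongrightarrow> - (0 / 2)) at_top"
      by (intro tendsto_minus tendsto_divide filterlim_compose[OF exp_at_bot] filterlim_uminus_at_bot_at_top) auto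
    then have "((\<lambda>x::real. - (exp (- (2 * x)) / 2)) \<longlongrightarrow> - (0 / 2)) at_top"
      by (rule filterlim_compose[where g = "\<lambda>x. - (exp (- x) / 2)"])
        (auto intro!: filterlim_tendsto_pos_mult_at_top[OF tendsto_const] filterlim_ident)
    then show "((\<lambda>x::real. - (exp (- 2 * x) / 2)) \<longlongrightarrow> 0) at_top" by simp
  qed (auto intro!: derivative_eq_intros)
  finally show ?thesis by simp
qed

definition step_sampler :: "'a pmf \<Rightarrow> (real \<Rightarrow> 'a \<times> real) \<Rightarrow> bool" where
  "step_sampler p F \<longleftrightarrow>
     F \<in> unif \<rightarrow>\<^sub>M count_space UNIV \<Otimes>\<^sub>M borel \<and>
     (\<forall>r. F r \<in> set_pmf p \<times> {0<..}) \<and>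
     distr unif (count_space UNIV \<Otimes>\<^sub>M borel) F = measure_pmf p \<Otimes>\<^sub>M expo"

text \<open>A pair \<open>(a, e)\<close> is coded by the single real whose integer part is the index of \<open>a\<close> and
  whose fractional part is \<open>e / (1 + e)\<close>; its law is then realised by the quantile transform.\<close>

lemma step_sampler_exists:
  fixes p :: "'a :: countable pmf"
  shows "\<exists>F. step_sampler p F"
proof -
  interpret expo: prob_space expo by (rule prob_space_expo)
  interpret PE: pair_prob_space "measure_pmf p" expo ..
  let ?CB = "count_space UNIV \<Otimes>\<^sub>M borel :: ('a \<times> real) measure"
  have sets_PE [measurable_cong]: "sets (measure_pmf p \<Otimes>\<^sub>M expo) = sets ?CB"
    by (intro sets_pair_measure_cong) auto
  define enc where "enc = (\<lambda>(a::'a, e::real). real (to_nat a) + e / (1 + e))"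
  define dec where "dec r = (from_nat (nat \<lfloor>r\<rfloor>) :: 'a, frac r / (1 - frac r))" for r :: real
  have [measurable]: "enc \<in> borel_measurable ?CB"
    unfolding enc_def by measurable
  have [measurable]: "dec \<in> borel \<rightarrow>\<^sub>M ?CB"
    unfolding dec_def frac_def by measurable
  have dec_enc: "dec (enc (a, e)) = (a, e)" if "0 < e" for a e
  proof -
    have 1: "0 < e / (1 + e)" "e / (1 + e) < 1"
      using that by auto
    then have "\<lfloor>real (to_nat a) + e / (1 + e)\<rfloor> = int (to_nat a)"
      by (intro floor_unique) auto
    then show ?thesis
      using that by (simp add: dec_def enc_def frac_def divide_simps)
  qed
  interpret D: cdf_distribution "distr (measure_pmf p \<Otimes>\<^sub>M expo) borel enc"
    unfolding cdf_distribution_def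
    by (intro PE.real_distribution_distr) measurable
  define G where "G = dec \<circ> D.I"
  have I_meas [measurable]: "D.I \<in> unif \<rightarrow>\<^sub>M borel"
    using D.measurable_CI
    by (subst measurable_cong_sets[where M' = "restrict_space borel {0<..<1}" and N' = borel])
      (auto simp: unif_def sets_restrict_space)
  have G_meas [measurable]: "G \<in> unif \<rightarrow>\<^sub>M ?CB"
    unfolding G_def by measurable
  have G_distr: "distr unif ?CB G = measure_pmf p \<Otimes>\<^sub>M expo"
  proof -
    have "distr unif ?CB G = distr (distr unif borel D.I) ?CB dec"
      unfolding G_def by (rule distr_distr[symmetric]) measurable
    also have "\<dots> = distr (measure_pmf p \<Otimes>\<^sub>M expo) ?CB (dec \<circ> enc)"
      unfolding unif_def D.distr_I_eq_M by (rule distr_distr) measurable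
    also have "\<dots> = distr (measure_pmf p \<Otimes>\<^sub>M expo) ?CB (\<lambda>x. x)"
    proof (rule distr_cong_AE)
      have "AE x in measure_pmf p \<Otimes>\<^sub>M expo. 0 < snd x"
        using AE_expo_pos by (intro PE.AE_pair_measure) auto
      then show "AE x in measure_pmf p \<Otimes>\<^sub>M expo. (dec \<circ> enc) x = x"
        by eventually_elim (auto simp: dec_enc)
    qed auto
    also have "\<dots> = measure_pmf p \<Otimes>\<^sub>M expo"
      by (rule distr_id2) (simp add: sets_PE)
    finally show ?thesis .
  qed
  obtain a0 where a0: "a0 \<in> set_pmf p" using set_pmf_not_empty[of p] by blast
  define F where "F r = (if G r \<in> set_pmf p \<times> {0<..} then G r else (a0, 1))" for r
  have AE: "AE r in unif. F r = G r"
  proof -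
    have "AE x in measure_pmf p \<Otimes>\<^sub>M expo. fst x \<in> set_pmf p \<and> 0 < snd x"
      using AE_expo_pos by (intro PE.AE_pair_measure) (auto simp: AE_measure_pmf_iff)
    then have "AE x in distr unif ?CB G. fst x \<in> set_pmf p \<and> 0 < snd x"
      by (simp only: G_distr)
    then have "AE r in unif. fst (G r) \<in> set_pmf p \<and> 0 < snd (G r)"
      by (rule AE_distrD[OF G_meas])
    then show ?thesis
      by eventually_elim (auto simp: F_def mem_Times_iff)
  qed
  have F_meas [measurable]: "F \<in> unif \<rightarrow>\<^sub>M ?CB"
    unfolding F_def mem_Times_iff by measurable
  have "distr unif ?CB F = distr unif ?CB G"
    by (rule distr_cong_AE) (auto simp: AE)
  moreover have "F r \<in> set_pmf p \<times> {0<..}" for r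
    using a0 by (auto simp: F_def)
  ultimately have "step_sampler p F"
    unfolding step_sampler_def by (auto simp: G_distr)
  then show ?thesis by blast
qed

lemma nn_integral_sampler:
  assumes F: "step_sampler p F"
    and [measurable]: "\<phi> \<in> borel_measurable (count_space UNIV \<Otimes>\<^sub>M borel)"
  shows "(\<integral>\<^sup>+r. \<phi> (F r) \<partial>unif) = (\<integral>\<^sup>+a. \<integral>\<^sup>+e. \<phi> (a, e) \<partial>expo \<partial>measure_pmf p)"
proof -
  interpret expo: prob_space expo by (rule prob_space_expo)
  have [measurable]: "F \<in> unif \<rightarrow>\<^sub>M count_space UNIV \<Otimes>\<^sub>M borel"
    using F by (simp add: step_sampler_def)
  have "(\<integral>\<^sup>+r. \<phi> (F r) \<partial>unif) = (\<integral>\<^sup>+x. \<phi> x \<partial>(measure_pmf p \<Otimes>\<^sub>M expo))"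
    using F nn_integral_distr[of F unif "count_space UNIV \<Otimes>\<^sub>M borel" \<phi>] by (simp add: step_sampler_def)
  also have "\<dots> = (\<integral>\<^sup>+a. \<integral>\<^sup>+e. \<phi> (a, e) \<partial>expo \<partial>measure_pmf p)"
  proof (rule expo.nn_integral_fst[symmetric])
    have "sets (measure_pmf p \<Otimes>\<^sub>M expo) = sets (count_space UNIV \<Otimes>\<^sub>M borel)"
      by (intro sets_pair_measure_cong) auto
    then show "\<phi> \<in> borel_measurable (measure_pmf p \<Otimes>\<^sub>M expo)"
      by (subst measurable_cong_sets[OF _ refl]) auto
  qed
  finally show ?thesis .
qed

definition seq_space :: "(nat \<Rightarrow> real) measure" where
  "seq_space = (\<Pi>\<^sub>M i\<in>UNIV. unif)"

lemma prob_space_seq_space: "prob_space seq_space"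
  unfolding seq_space_def by (intro prob_space_PiM prob_space_unif)

lemma measurable_seq_component [measurable (raw)]:
  "f \<in> M \<rightarrow>\<^sub>M seq_space \<Longrightarrow> (\<lambda>x. f x i) \<in> M \<rightarrow>\<^sub>M unif"
  unfolding seq_space_def by (rule measurable_compose[OF _ measurable_component_singleton]) auto

lemma measurable_seq_reindex: "(\<lambda>c n. c (g n)) \<in> seq_space \<rightarrow>\<^sub>M seq_space"
proof -
  have "(\<lambda>c n. c (g n)) \<in> seq_space \<rightarrow>\<^sub>M (\<Pi>\<^sub>M i\<in>UNIV. unif)"
  proof (rule measurable_PiM_single')
    show "(\<lambda>c. c (g n)) \<in> seq_space \<rightarrow>\<^sub>M unif" for n
      by (rule measurable_seq_component) simp
    show "(\<lambda>c n. c (g n)) \<in> space seq_space \<rightarrow> (UNIV \<rightarrow>\<^sub>E space unif)"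
      by (auto simp: seq_space_def space_PiM)
  qed
  then show ?thesis by (simp only: seq_space_def)
qed

lemma measurable_seq_shift [measurable]: "(\<lambda>c n. c (Suc n)) \<in> seq_space \<rightarrow>\<^sub>M seq_space"
  by (rule measurable_seq_reindex)

lemma nn_integral_seq_space:
  assumes "\<phi> \<in> borel_measurable seq_space"
  shows "(\<integral>\<^sup>+c. \<phi> c \<partial>seq_space) = (\<integral>\<^sup>+r. \<integral>\<^sup>+c. \<phi> (case_nat r c) \<partial>seq_space \<partial>unif)"
proof -
  interpret unif: prob_space unif by (rule prob_space_unif)
  interpret sequence_space unif ..
  have *: "(\<lambda>(s, \<omega>). case_nat s \<omega>) \<in> unif \<Otimes>\<^sub>M S \<rightarrow>\<^sub>M S"
    by measurable
  have \<phi> [measurable]: "\<phi> \<in> borel_measurable S" using assms by (simp add: seq_space_def)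
  have "(\<integral>\<^sup>+c. \<phi> c \<partial>S) = (\<integral>\<^sup>+c. \<phi> c \<partial>distr (unif \<Otimes>\<^sub>M S) S (\<lambda>(s, \<omega>). case_nat s \<omega>))"
    by (simp only: PiM_iter)
  also have "\<dots> = (\<integral>\<^sup>+x. \<phi> (case x of (s, \<omega>) \<Rightarrow> case_nat s \<omega>) \<partial>(unif \<Otimes>\<^sub>M S))"
    using * \<phi> by (intro nn_integral_distr) auto
  also have "\<dots> = (\<integral>\<^sup>+r. \<integral>\<^sup>+c. \<phi> (case_nat r c) \<partial>S \<partial>unif)"
    using measurable_compose[OF * \<phi>] by (subst nn_integral_fst[symmetric]) (simp_all )
  finally show ?thesis by (simp add: seq_space_def)
qed

definition seq_split :: "(nat \<Rightarrow> real) \<Rightarrow> (nat \<Rightarrow> real) \<times> (nat \<Rightarrow> real)" where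
  "seq_split \<omega> = (\<lambda>n. \<omega> (2 * n), \<lambda>n. \<omega> (2 * n + 1))"

lemma measurable_seq_split [measurable]: "seq_split \<in> seq_space \<rightarrow>\<^sub>M seq_space \<Otimes>\<^sub>M seq_space"
  unfolding seq_split_def by (rule measurable_Pair; rule measurable_seq_reindex)

lemma distr_seq_split: "distr seq_space (seq_space \<Otimes>\<^sub>M seq_space) seq_split = seq_space \<Otimes>\<^sub>M seq_space"
proof -
  interpret unif: prob_space unif by (rule prob_space_unif)
  interpret sequence_space unif ..
  define mrg where "mrg = (\<lambda>(a::nat \<Rightarrow> real, b::nat \<Rightarrow> real) n. if even n then a (n div 2) else b (n div 2))"
  have mrg [measurable]: "mrg \<in> S \<Otimes>\<^sub>M S \<rightarrow>\<^sub>M S"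
  proof (rule measurable_PiM_single')
    show "(\<lambda>x. mrg x n) \<in> S \<Otimes>\<^sub>M S \<rightarrow>\<^sub>M unif" for n
      by (cases "even n") (simp_all add: mrg_def split_beta')
    show "mrg \<in> space (S \<Otimes>\<^sub>M S) \<rightarrow> UNIV \<rightarrow>\<^sub>E space unif"
      by (auto simp: mrg_def space_pair_measure space_PiM PiE_iff)
  qed
  have "distr (S \<Otimes>\<^sub>M S) S mrg = S"
  proof (rule PiM_eq)
    fix J :: "nat set" and A assume J: "finite J" "J \<subseteq> UNIV" "\<And>j. j \<in> J \<Longrightarrow> A j \<in> sets unif"
    let ?KA = "(\<lambda>n. 2 * n) -` J" and ?KB = "(\<lambda>n. 2 * n + 1) -` J"
    have fin: "finite ?KA" "finite ?KB"
      using J(1) by (auto intro!: finite_vimageI injI)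
    let ?X = "prod_emb UNIV (\<lambda>_. unif) J (Pi\<^sub>E J A)"
    let ?XA = "prod_emb UNIV (\<lambda>_. unif) ?KA (Pi\<^sub>E ?KA (\<lambda>n. A (2 * n)))"
    let ?XB = "prod_emb UNIV (\<lambda>_. unif) ?KB (Pi\<^sub>E ?KB (\<lambda>n. A (2 * n + 1)))"
    have sub: "j \<in> J \<Longrightarrow> x \<in> A j \<Longrightarrow> x \<in> space unif" for j x
      using J(3)[THEN sets.sets_into_space] by auto
    have "mrg -` ?X \<inter> space (S \<Otimes>\<^sub>M S) = ?XA \<times> ?XB"
    proof -
     have 1: "a \<in> ?XA \<and> b \<in> ?XB" if *: "mrg (a, b) \<in> ?X" "(a, b) \<in> space (S \<Otimes>\<^sub>M S)" for a b
     proof -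
      from * have m: "mrg (a, b) j \<in> A j" if "j \<in> J" for j using that by (auto simp: prod_emb_def)
      have "a n \<in> A (2 * n)" if "2 * n \<in> J" for n
        using m[OF that] by (simp add: mrg_def)
      moreover have "b n \<in> A (2 * n + 1)" if "2 * n + 1 \<in> J" for n
        using m[OF that] by (simp add: mrg_def)
      ultimately show ?thesis
        using *(2) by (auto simp: prod_emb_def space_pair_measure space_PiM)
     qed
     have 2: "mrg (a, b) \<in> ?X \<and> (a, b) \<in> space (S \<Otimes>\<^sub>M S)" if *: "a \<in> ?XA" "b \<in> ?XB" for a b
     proof -
      have "mrg (a, b) j \<in> A j" if "j \<in> J" for j
      proof (cases "even j")
        case True
        then show ?thesis using * that by (auto simp: mrg_def prod_emb_def PiE_iff)
      next
        case False
        then have j: "2 * (j div 2) + 1 = j" by simp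
        then have "j div 2 \<in> ?KB" using that by simp
        then have "b (j div 2) \<in> A (2 * (j div 2) + 1)" using * by (auto simp: prod_emb_def PiE_iff)
        then show ?thesis using False unfolding j by (simp add: mrg_def)
      qed
      moreover have "mrg (a, b) \<in> space S" "(a, b) \<in> space (S \<Otimes>\<^sub>M S)"
        using * by (auto simp: mrg_def prod_emb_def space_pair_measure space_PiM PiE_iff)
      ultimately show ?thesis
        by (auto simp: prod_emb_def space_PiM)
     qed
     show ?thesis
     proof (rule set_eqI)
       fix x :: "(nat \<Rightarrow> real) \<times> (nat \<Rightarrow> real)"
       obtain a b where x: "x = (a, b)" by (cases x)
       show "x \<in> mrg -` ?X \<inter> space (S \<Otimes>\<^sub>M S) \<longleftrightarrow> x \<in> ?XA \<times> ?XB"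
         unfolding x mem_Times_iff Int_iff vimage_eq fst_conv snd_conv
         using 1[of a b] 2[of a b] by blast
     qed
    qed
    then have "emeasure (distr (S \<Otimes>\<^sub>M S) S mrg) ?X = emeasure (S \<Otimes>\<^sub>M S) (?XA \<times> ?XB)"
      using J by (subst emeasure_distr) (auto intro!: sets_PiM_I)
    also have "\<dots> = emeasure S ?XA * emeasure S ?XB"
      using J fin by (intro P.emeasure_pair_measure_Times) (auto intro!: sets_PiM_I)
    also have "\<dots> = (\<Prod>j\<in>?KA. emeasure unif (A (2 * j))) * (\<Prod>j\<in>?KB. emeasure unif (A (2 * j + 1)))"
      using J fin by (intro arg_cong2[where f = "(*)"] emeasure_PiM_emb) auto
    also have "(\<Prod>j\<in>?KA. emeasure unif (A (2 * j))) = (\<Prod>j\<in>{j\<in>J. even j}. emeasure unif (A j))"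
      by (rule prod.reindex_bij_witness[of _ "\<lambda>j. j div 2" "\<lambda>j. 2 * j"]) auto
    also have "(\<Prod>j\<in>?KB. emeasure unif (A (2 * j + 1))) = (\<Prod>j\<in>{j\<in>J. odd j}. emeasure unif (A j))"
      by (rule prod.reindex_bij_witness[of _ "\<lambda>j. j div 2" "\<lambda>j. 2 * j + 1"]) auto
    also have "(\<Prod>j\<in>{j\<in>J. even j}. emeasure unif (A j)) * (\<Prod>j\<in>{j\<in>J. odd j}. emeasure unif (A j)) =
        (\<Prod>j\<in>{j\<in>J. even j} \<union> {j\<in>J. odd j}. emeasure unif (A j))"
      using J by (intro prod.union_disjoint[symmetric]) auto
    also have "{j\<in>J. even j} \<union> {j\<in>J. odd j} = J" by auto
    finally show "emeasure (distr (S \<Otimes>\<^sub>M S) S mrg) ?X = (\<Prod>j\<in>J. emeasure unif (A j))" .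
  qed simp_all
  then have "distr S (S \<Otimes>\<^sub>M S) seq_split = distr (distr (S \<Otimes>\<^sub>M S) S mrg) (S \<Otimes>\<^sub>M S) seq_split"
    by simp
  also have "\<dots> = distr (S \<Otimes>\<^sub>M S) (S \<Otimes>\<^sub>M S) (seq_split \<circ> mrg)"
    using measurable_seq_split mrg unfolding seq_space_def by (rule distr_distr)
  also have "seq_split \<circ> mrg = (\<lambda>x. x)"
    by (auto simp: fun_eq_iff seq_split_def mrg_def)
  also have "distr (S \<Otimes>\<^sub>M S) (S \<Otimes>\<^sub>M S) (\<lambda>x. x) = S \<Otimes>\<^sub>M S"
    by (rule distr_id2) simp
  finally show ?thesis unfolding seq_space_def .
qed

section \<open>Jump kernels\<close>

lemma
  assumes "rate_matrix E q" "x \<in> E"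
  shows hold_rate_nonneg: "0 \<le> hold_rate q x"
    and nn_integral_offdiagonal_rates: "(\<integral>\<^sup>+z. ennreal (if z = x then 0 else qbar E q x z) \<partial>count_space UNIV) = ennreal (hold_rate q x)"
proof -
  have "(q x has_sum 0) E" and nonneg: "\<And>z. z \<in> E - {x} \<Longrightarrow> 0 \<le> q x z"
    using assms by (auto simp: rate_matrix_def)
  moreover have "(q x has_sum q x x) {x}" by (rule has_sum_finiteI) auto
  ultimately have sum: "(q x has_sum (0 - q x x)) (E - {x})"
    using assms by (intro has_sum_Diff) auto
  show "0 \<le> hold_rate q x"
    using has_sum_nonneg[OF sum nonneg] by (simp add: hold_rate_def)
  have "Infinite_Sum.abs_summable_on (q x) (E - {x})"
    using has_sum_imp_summable[OF sum] nonneg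
    by (subst summable_on_iff_abs_summable_on_real[symmetric])
  then have abs: "Infinite_Set_Sum.abs_summable_on (q x) (E - {x})"
    by (simp only: abs_summable_equivalent)
  have "(\<integral>\<^sup>+z. ennreal (if z = x then 0 else qbar E q x z) \<partial>count_space UNIV) =
      (\<integral>\<^sup>+z. ennreal (q x z) * indicator (E - {x}) z \<partial>count_space UNIV)"
    by (intro nn_integral_cong) (auto simp: qbar_def indicator_def)
  also have "\<dots> = (\<integral>\<^sup>+z. ennreal (q x z) \<partial>count_space (E - {x}))"
    by (simp add: nn_integral_count_space_indicator)
  also have "\<dots> = ennreal (infsetsum (q x) (E - {x}))"
    using abs nonneg by (intro nn_integral_conv_infsetsum) auto
  also have "infsetsum (q x) (E - {x}) = hold_rate q x"
    using infsumI[OF sum] infsetsum_infsum[OF abs] by (simp add: hold_rate_def)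
  finally show "(\<integral>\<^sup>+z. ennreal (if z = x then 0 else qbar E q x z) \<partial>count_space UNIV) = ennreal (hold_rate q x)" .
qed

lemma rate_eq_hold_rate_times_jump_prob:
  assumes "rate_matrix E q" "x \<in> E" "z \<in> E" "z \<noteq> x"
  shows "q x z = hold_rate q x * jump_prob q x z"
proof (cases "hold_rate q x = 0")
  case True
  then have "(\<integral>\<^sup>+z. ennreal (if z = x then 0 else qbar E q x z) \<partial>count_space UNIV) = 0"
    using nn_integral_offdiagonal_rates[OF assms(1,2)] by simp
  then have "AE z in count_space UNIV. ennreal (if z = x then 0 else qbar E q x z) = 0"
    by (subst (asm) nn_integral_0_iff_AE) auto
  then have "ennreal (if z = x then 0 else qbar E q x z) = 0"
    by (simp add: AE_count_space)
  then have "q x z \<le> 0" using assms by (simp add: qbar_def ennreal_eq_0_iff)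
  moreover have "0 \<le> q x z" using assms by (auto simp: rate_matrix_def)
  ultimately show ?thesis using True by simp
next
  case False
  then show ?thesis using assms by (simp add: jump_prob_def)
qed

lemma pmf_with_weights_exists:
  assumes "\<And>x. 0 \<le> f x" "(\<integral>\<^sup>+x. ennreal (f x) \<partial>count_space UNIV) = ennreal L" "0 < L"
  shows "\<exists>p. \<forall>x. pmf p x = f x / L"
proof -
  have "(\<integral>\<^sup>+x. ennreal (f x / L) \<partial>count_space UNIV) = (\<integral>\<^sup>+x. ennreal (f x) / ennreal L \<partial>count_space UNIV)"
    using assms by (intro nn_integral_cong) (simp add: divide_ennreal)
  also have "\<dots> = ennreal L / ennreal L"
    using assms by (simp add: nn_integral_divide)
  also have "\<dots> = 1" using assms by (simp add: divide_ennreal)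
  finally have "pmf (embed_pmf (\<lambda>x. f x / L)) x = f x / L" for x
    using assms by (intro pmf_embed_pmf) auto
  then show ?thesis by blast
qed

lemma jump_chain_pmf_exists:
  assumes "rate_matrix E q" "x \<in> E"
  shows "\<exists>p. set_pmf p \<subseteq> E \<and> (\<forall>z\<in>E. pmf p z = jump_prob q x z)"
proof (cases "hold_rate q x = 0")
  case True
  then show ?thesis
    using assms by (intro exI[of _ "return_pmf x"]) (auto simp: jump_prob_def)
next
  case False
  then have "0 < hold_rate q x" using hold_rate_nonneg[OF assms] by simp
  moreover have "0 \<le> (if z = x then 0 else qbar E q x z)" for z
    using assms by (auto simp: rate_matrix_def qbar_def)
  ultimately obtain p where p: "\<And>z. pmf p z = (if z = x then 0 else qbar E q x z) / hold_rate q x"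
    using pmf_with_weights_exists[OF _ nn_integral_offdiagonal_rates[OF assms]] by blast
  then have "set_pmf p \<subseteq> E" by (auto simp: set_pmf_iff qbar_def split: if_splits)
  then show ?thesis using p False by (intro exI[of _ p]) (auto simp: jump_prob_def qbar_def)
qed

lemma pmf_at_zero:
  assumes "\<And>\<xi>. \<xi> \<noteq> 0 \<Longrightarrow> pmf p \<xi> = a \<xi> / L" "\<And>\<xi>. 0 \<le> a \<xi>" "a 0 = 0" "0 < L"
    and "(\<integral>\<^sup>+\<xi>. ennreal (a \<xi>) \<partial>count_space UNIV) = ennreal \<alpha>" "0 \<le> \<alpha>"
  shows "pmf p 0 = 1 - \<alpha> / L"
proof -
  have "1 = (\<integral>\<^sup>+\<xi>. ennreal (pmf p \<xi>) \<partial>count_space UNIV)"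
    by (simp add: nn_integral_pmf measure_pmf.emeasure_space_1[of p, simplified])
  also have "\<dots> = (\<integral>\<^sup>+\<xi>. ennreal (a \<xi>) / ennreal L + ennreal (pmf p 0) * indicator {0} \<xi> \<partial>count_space UNIV)"
    using assms by (intro nn_integral_cong) (auto simp: divide_ennreal indicator_def)
  also have "\<dots> = ennreal \<alpha> / ennreal L + ennreal (pmf p 0)"
    using assms by (simp add: nn_integral_add nn_integral_divide nn_integral_cmult_indicator)
  also have "\<dots> = ennreal (\<alpha> / L + pmf p 0)"
    using assms by (simp add: divide_ennreal ennreal_plus)
  finally have "1 = \<alpha> / L + pmf p 0"
    using assms by (metis add_nonneg_nonneg divide_nonneg_pos ennreal_1 ennreal_inj pmf_nonneg zero_le_one)
  then show ?thesis by simp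
qed

lemma pmf_map_fst: "ennreal (pmf (map_pmf fst J) x) = (\<integral>\<^sup>+y. ennreal (pmf J (x, y)) \<partial>count_space UNIV)"
proof -
  have "ennreal (pmf (map_pmf fst J) x) = emeasure (measure_pmf J) (fst -` {x})"
    by (simp add: pmf_map measure_pmf.emeasure_eq_measure)
  also have "\<dots> = (\<integral>\<^sup>+w. ennreal (pmf J w) \<partial>count_space (fst -` {x}))"
    by (simp add: nn_integral_pmf)
  also have "\<dots> = (\<integral>\<^sup>+y. ennreal (pmf J (x, y)) \<partial>count_space UNIV)"
    by (rule nn_integral_bij_count_space[symmetric]) (auto simp: bij_betw_def inj_on_def)
  finally show ?thesis .
qed

lemma pmf_map_snd: "ennreal (pmf (map_pmf snd J) y) = (\<integral>\<^sup>+x. ennreal (pmf J (x, y)) \<partial>count_space UNIV)"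
proof -
  have "ennreal (pmf (map_pmf snd J) y) = emeasure (measure_pmf J) (snd -` {y})"
    by (simp add: pmf_map measure_pmf.emeasure_eq_measure)
  also have "\<dots> = (\<integral>\<^sup>+w. ennreal (pmf J w) \<partial>count_space (snd -` {y}))"
    by (simp add: nn_integral_pmf)
  also have "\<dots> = (\<integral>\<^sup>+x. ennreal (pmf J (x, y)) \<partial>count_space UNIV)"
    by (rule nn_integral_bij_count_space[symmetric]) (auto simp: bij_betw_def inj_on_def)
  finally show ?thesis .
qed

lemma coupled_increments_exist:
  fixes a b :: "'v :: zero \<Rightarrow> real"
  assumes a: "\<And>\<xi>. 0 \<le> a \<xi>" "a 0 = 0" "(\<integral>\<^sup>+\<xi>. ennreal (a \<xi>) \<partial>count_space UNIV) = ennreal \<alpha>" "0 \<le> \<alpha>"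
    and b: "\<And>\<xi>. 0 \<le> b \<xi>" "b 0 = 0" "(\<integral>\<^sup>+\<xi>. ennreal (b \<xi>) \<partial>count_space UNIV) = ennreal \<beta>" "0 \<le> \<beta>"
    and L: "\<alpha> + \<beta> < L"
  shows "\<exists>J :: ('v \<times> 'v) pmf.
    (\<forall>\<xi>. \<xi> \<noteq> 0 \<longrightarrow> pmf (map_pmf fst J) \<xi> = a \<xi> / L) \<and> pmf (map_pmf fst J) 0 = 1 - \<alpha> / L \<and>
    (\<forall>\<xi>. \<xi> \<noteq> 0 \<longrightarrow> pmf (map_pmf snd J) \<xi> = b \<xi> / L) \<and> pmf (map_pmf snd J) 0 = 1 - \<beta> / L \<and>
    (\<forall>\<xi> \<eta>. (\<xi>, \<eta>) \<in> set_pmf J \<longrightarrow> \<xi> = 0 \<and> \<eta> = 0 \<or> \<xi> = \<eta> \<and> 0 < a \<xi> \<and> 0 < b \<xi> \<or>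
        \<eta> = 0 \<and> b \<xi> < a \<xi> \<or> \<xi> = 0 \<and> a \<eta> < b \<eta>)"
proof -
  define \<delta> where "\<delta> = enn2real (\<integral>\<^sup>+\<xi>. ennreal (max 0 (b \<xi> - a \<xi>)) \<partial>count_space UNIV)"
  have le: "(\<integral>\<^sup>+\<xi>. ennreal (max 0 (b \<xi> - a \<xi>)) \<partial>count_space UNIV) \<le> ennreal \<beta>"
    unfolding b(3)[symmetric] using a b by (intro nn_integral_mono ennreal_leI) auto
  then have \<delta>: "ennreal \<delta> = (\<integral>\<^sup>+\<xi>. ennreal (max 0 (b \<xi> - a \<xi>)) \<partial>count_space UNIV)"
    unfolding \<delta>_def by (intro ennreal_enn2real) (auto simp: top_unique intro: le_less_trans)
  have \<delta>': "0 \<le> \<delta>" "\<delta> \<le> \<beta>"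
    using le b(4) by (auto simp: \<delta>_def intro: enn2real_leI)
  have L0: "0 < L" using a(4) b(4) L by simp
  define r where "r = (\<lambda>(\<xi>, \<eta>). if \<xi> = 0 \<and> \<eta> = 0 then L - \<alpha> - \<delta> else if \<xi> = \<eta> then min (a \<xi>) (b \<xi>)
      else if \<eta> = 0 then max 0 (a \<xi> - b \<xi>) else if \<xi> = 0 then max 0 (b \<eta> - a \<eta>) else 0)"
  have r_nonneg: "0 \<le> r w" for w
    using a b L \<delta>' by (auto simp: r_def split: prod.split)
  have row: "(\<integral>\<^sup>+\<eta>. ennreal (r (\<xi>, \<eta>)) \<partial>count_space UNIV) = ennreal (a \<xi>)" if "\<xi> \<noteq> 0" for \<xi>
  proof -
    have "(\<integral>\<^sup>+\<eta>. ennreal (r (\<xi>, \<eta>)) \<partial>count_space UNIV) = (\<Sum>\<eta>\<in>{\<xi>, 0}. ennreal (r (\<xi>, \<eta>)))"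
      using that by (intro nn_integral_count_space') (auto simp: r_def)
    also have "\<dots> = ennreal (min (a \<xi>) (b \<xi>) + max 0 (a \<xi> - b \<xi>))"
      using that a b by (subst ennreal_plus) (auto simp: r_def)
    also have "min (a \<xi>) (b \<xi>) + max 0 (a \<xi> - b \<xi>) = a \<xi>" by (auto simp: min_def max_def)
    finally show ?thesis .
  qed
  have col: "(\<integral>\<^sup>+\<xi>. ennreal (r (\<xi>, \<eta>)) \<partial>count_space UNIV) = ennreal (b \<eta>)" if "\<eta> \<noteq> 0" for \<eta>
  proof -
    have "(\<integral>\<^sup>+\<xi>. ennreal (r (\<xi>, \<eta>)) \<partial>count_space UNIV) = (\<Sum>\<xi>\<in>{\<eta>, 0}. ennreal (r (\<xi>, \<eta>)))"
      using that by (intro nn_integral_count_space') (auto simp: r_def)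
    also have "\<dots> = ennreal (min (a \<eta>) (b \<eta>) + max 0 (b \<eta> - a \<eta>))"
      using that a b by (subst ennreal_plus) (auto simp: r_def)
    also have "min (a \<eta>) (b \<eta>) + max 0 (b \<eta> - a \<eta>) = b \<eta>" by (auto simp: min_def max_def)
    finally show ?thesis .
  qed
  have row0: "(\<integral>\<^sup>+\<eta>. ennreal (r (0, \<eta>)) \<partial>count_space UNIV) = ennreal (L - \<alpha>)"
  proof -
    have "(\<integral>\<^sup>+\<eta>. ennreal (r (0, \<eta>)) \<partial>count_space UNIV) =
        (\<integral>\<^sup>+\<eta>. ennreal (max 0 (b \<eta> - a \<eta>)) + ennreal (L - \<alpha> - \<delta>) * indicator {0} \<eta> \<partial>count_space UNIV)"
      using a b by (intro nn_integral_cong) (auto simp: r_def indicator_def)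
    also have "\<dots> = ennreal \<delta> + ennreal (L - \<alpha> - \<delta>)"
      by (simp add: nn_integral_add \<delta> nn_integral_cmult_indicator)
    also have "\<dots> = ennreal (L - \<alpha>)"
      using \<delta>' L by (subst ennreal_plus[symmetric]) auto
    finally show ?thesis .
  qed
  have "(\<integral>\<^sup>+w. ennreal (r w) \<partial>count_space UNIV) =
      (\<integral>\<^sup>+\<xi>. \<integral>\<^sup>+\<eta>. ennreal (r (\<xi>, \<eta>)) \<partial>count_space UNIV \<partial>count_space UNIV)"
    by (rule nn_integral_fst_count_space[symmetric])
  also have "\<dots> = (\<integral>\<^sup>+\<xi>. ennreal (a \<xi>) + ennreal (L - \<alpha>) * indicator {0} \<xi> \<partial>count_space UNIV)"
    using row row0 a by (intro nn_integral_cong) (auto simp: indicator_def)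
  also have "\<dots> = ennreal \<alpha> + ennreal (L - \<alpha>)"
    by (simp add: nn_integral_add a nn_integral_cmult_indicator)
  also have "\<dots> = ennreal L"
    using a b L by (subst ennreal_plus[symmetric]) auto
  finally obtain J where J: "\<And>w. pmf J w = r w / L"
    using pmf_with_weights_exists[of r L] r_nonneg L0 by blast
  have fst: "pmf (map_pmf fst J) \<xi> = a \<xi> / L" if "\<xi> \<noteq> 0" for \<xi>
  proof -
    have "ennreal (pmf (map_pmf fst J) \<xi>) = (\<integral>\<^sup>+\<eta>. ennreal (r (\<xi>, \<eta>)) / ennreal L \<partial>count_space UNIV)"
      unfolding pmf_map_fst J using L0 r_nonneg by (simp add: divide_ennreal)
    also have "\<dots> = ennreal (a \<xi> / L)"
      using row[OF that] a L0 by (simp add: nn_integral_divide divide_ennreal)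
    finally show ?thesis using a L0 by simp
  qed
  have snd: "pmf (map_pmf snd J) \<eta> = b \<eta> / L" if "\<eta> \<noteq> 0" for \<eta>
  proof -
    have "ennreal (pmf (map_pmf snd J) \<eta>) = (\<integral>\<^sup>+\<xi>. ennreal (r (\<xi>, \<eta>)) / ennreal L \<partial>count_space UNIV)"
      unfolding pmf_map_snd J using L0 r_nonneg by (simp add: divide_ennreal)
    also have "\<dots> = ennreal (b \<eta> / L)"
      using col[OF that] b L0 by (simp add: nn_integral_divide divide_ennreal)
    finally show ?thesis using b L0 by simp
  qed
  have "\<xi> = 0 \<and> \<eta> = 0 \<or> \<xi> = \<eta> \<and> 0 < a \<xi> \<and> 0 < b \<xi> \<or> \<eta> = 0 \<and> b \<xi> < a \<xi> \<or> \<xi> = 0 \<and> a \<eta> < b \<eta>"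
    if "(\<xi>, \<eta>) \<in> set_pmf J" for \<xi> \<eta>
  proof -
    have "0 < r (\<xi>, \<eta>)"
      using that L0 pmf_positive[OF that] by (simp add: J zero_less_divide_iff)
    then show ?thesis by (auto simp: r_def max_def split: if_splits)
  qed
  then show ?thesis
    using fst snd pmf_at_zero[OF fst a(1,2) L0 a(3,4)] pmf_at_zero[OF snd b(1,2) L0 b(3,4)]
    by (intro exI[of _ J]) auto
qed

section \<open>Trajectories\<close>

text \<open>\<open>walk F k w c\<close> is the state after \<open>k\<close> steps together with the unit-rate exponential time
  drawn there.\<close>

primrec walk :: "('w \<Rightarrow> real \<Rightarrow> 'w \<times> real) \<Rightarrow> nat \<Rightarrow> 'w \<Rightarrow> (nat \<Rightarrow> real) \<Rightarrow> 'w \<times> real" where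
  "walk F 0 w c = (w, snd (F w (c 0)))"
| "walk F (Suc k) w c = walk F k (fst (F w (c 0))) (\<lambda>n. c (Suc n))"

lemma ennreal_less_ennreal_pos: "0 < b \<Longrightarrow> ennreal a < ennreal b \<longleftrightarrow> a < b"
  by (cases "0 \<le> a") (auto simp: ennreal_less_iff ennreal_neg)

definition traj_event :: "nat \<Rightarrow> (nat \<Rightarrow> 'a) \<Rightarrow> (nat \<Rightarrow> real) \<Rightarrow> (nat \<Rightarrow> 'a \<times> ennreal) \<Rightarrow> bool" where
  "traj_event n z t s \<longleftrightarrow> (\<forall>k\<le>n. fst (s k) = z k) \<and> (\<forall>k<n. ennreal (t k) < snd (s k))"

text \<open>Conditioning on a first step shortens the first time bound, which may then become negative;
  this is why \<open>max 0\<close> occurs.\<close>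

definition traj_prob :: "('a \<Rightarrow> 'a \<Rightarrow> real) \<Rightarrow> nat \<Rightarrow> (nat \<Rightarrow> 'a) \<Rightarrow> (nat \<Rightarrow> real) \<Rightarrow> real" where
  "traj_prob q n z t =
     (\<Prod>k<n. exp (- (hold_rate q (z k) * max 0 (t k))) * jump_prob q (z k) (z (Suc k)))"

lemma traj_event_0: "traj_event 0 z t s \<longleftrightarrow> fst (s 0) = z 0"
  by (simp add: traj_event_def)

lemma traj_event_Suc:
  "traj_event (Suc n) z t s \<longleftrightarrow> fst (s 0) = z 0 \<and> ennreal (t 0) < snd (s 0) \<and>
     traj_event n (\<lambda>k. z (Suc k)) (\<lambda>k. t (Suc k)) (\<lambda>k. s (Suc k))"
  unfolding traj_event_def less_Suc_eq_le all_simps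
  by (auto simp: less_Suc_eq_0_disj less_Suc_eq_le simp flip: less_Suc_eq_le)

lemma traj_prob_Suc:
  "traj_prob q (Suc n) z t = exp (- (hold_rate q (z 0) * max 0 (t 0))) * jump_prob q (z 0) (z 1) *
     traj_prob q n (\<lambda>k. z (Suc k)) (\<lambda>k. t (Suc k))"
  unfolding traj_prob_def by (subst prod.lessThan_Suc_shift) simp

text \<open>Trajectories are sequences of (state, holding time). A step that leaves the projected state
  unchanged lengthens the first holding time instead of adding an entry.\<close>

definition attach :: "'a \<Rightarrow> 'a \<Rightarrow> ennreal \<Rightarrow> (nat \<Rightarrow> 'a \<times> ennreal) \<Rightarrow> nat \<Rightarrow> 'a \<times> ennreal" where
  "attach x y h s = (if x = y then s(0 := (fst (s 0), h + snd (s 0))) else case_nat (x, h) s)"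

lemma traj_event_attach_same:
  assumes "0 < h" "0 < snd (s 0)"
  shows "traj_event (Suc n) z t (attach x x (ennreal h) s) \<longleftrightarrow> traj_event (Suc n) z (t(0 := t 0 - h)) s"
proof -
  have "ennreal (t 0) < ennreal h + snd (s 0) \<longleftrightarrow> ennreal (t 0 - h) < snd (s 0)"
  proof (cases "h \<le> t 0")
    case True
    then have "ennreal (t 0) = ennreal h + ennreal (t 0 - h)"
      using assms by (subst ennreal_plus[symmetric]) auto
    then show ?thesis by simp
  next
    case False
    then have "ennreal (t 0) < ennreal h" using assms by (simp add: ennreal_less_ennreal_pos)
    then show ?thesis using False assms(2)
      by (auto simp: ennreal_neg intro: less_le_trans)
  qed
  then show ?thesis by (simp add: traj_event_Suc attach_def)
qed

lemma traj_event_attach_diff: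
  assumes "x \<noteq> y"
  shows "traj_event (Suc n) z t (attach x y (ennreal h) s) \<longleftrightarrow>
    x = z 0 \<and> ennreal (t 0) < ennreal h \<and> traj_event n (\<lambda>k. z (Suc k)) (\<lambda>k. t (Suc k)) s"
  using assms by (simp add: traj_event_Suc attach_def)

lemma measurable_walk [measurable]:
  fixes F :: "'w :: countable \<Rightarrow> real \<Rightarrow> 'w \<times> real"
  assumes F: "\<And>w. F w \<in> unif \<rightarrow>\<^sub>M count_space UNIV \<Otimes>\<^sub>M borel"
  shows "walk F k w \<in> seq_space \<rightarrow>\<^sub>M count_space UNIV \<Otimes>\<^sub>M borel"
proof (induction k arbitrary: w)
  case 0
  note F [measurable]
  show ?case by simp
next
  case (Suc k)
  note F [measurable] Suc [measurable]
  have "(\<lambda>c. walk F k (fst (F w (c 0))) (\<lambda>n. c (Suc n))) \<in> seq_space \<rightarrow>\<^sub>M count_space UNIV \<Otimes>\<^sub>M borel"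
    by (rule measurable_compose_countable[where f = "\<lambda>w' c. walk F k w' (\<lambda>n. c (Suc n))"])
      measurable
  then show ?case by simp
qed

lemma walk_in:
  assumes "\<And>w. step_sampler (J w) (F w)" "\<And>w. w \<in> V \<Longrightarrow> set_pmf (J w) \<subseteq> V" "w \<in> V"
  shows "fst (walk F k w c) \<in> V" "0 < snd (walk F k w c)"
proof -
  have F: "fst (F w r) \<in> set_pmf (J w)" "0 < snd (F w r)" for w r
    using assms(1)[of w] by (auto simp: step_sampler_def mem_Times_iff)
  have "fst (walk F k w c) \<in> V \<and> 0 < snd (walk F k w c)"
    using assms(3)
  proof (induction k arbitrary: w c)
    case (Suc k)
    have "fst (F w (c 0)) \<in> V" using F(1)[of w] assms(2)[OF Suc.prems] by blast
    then show ?case using Suc.IH by simp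
  qed (simp add: F)
  then show "fst (walk F k w c) \<in> V" "0 < snd (walk F k w c)" by auto
qed

text \<open>Conditionally on the past each waiting time is exponential, so the Laplace transform of
  their partial sums is \<open>(1/2)^n\<close>.\<close>

lemma AE_waiting_times_not_summable:
  fixes F :: "'w :: countable \<Rightarrow> real \<Rightarrow> 'w \<times> real"
  assumes F: "\<And>w. step_sampler (J w) (F w)"
  shows "AE c in seq_space. \<not> summable (\<lambda>k. snd (walk F k w c))"
proof -
  have F_meas [measurable]: "F w \<in> unif \<rightarrow>\<^sub>M count_space UNIV \<Otimes>\<^sub>M borel" for w
    using F by (simp add: step_sampler_def)
  interpret seq: prob_space seq_space by (rule prob_space_seq_space)
  interpret expo: prob_space expo by (rule prob_space_expo)
  have pos: "0 < snd (walk F k w c)" for k w c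
    using walk_in(2)[OF F, where V = UNIV] by simp
  have int: "(\<integral>\<^sup>+c. ennreal (exp (- (\<Sum>k<n. snd (walk F k w c)))) \<partial>seq_space) = ennreal ((1 / 2) ^ n)" for n w
  proof (induction n arbitrary: w)
    case 0
    then show ?case by (simp add: seq.emeasure_space_1)
  next
    case (Suc n)
    have "(\<integral>\<^sup>+c. ennreal (exp (- (\<Sum>k<Suc n. snd (walk F k w c)))) \<partial>seq_space) =
      (\<integral>\<^sup>+r. \<integral>\<^sup>+c. ennreal (exp (- (\<Sum>k<Suc n. snd (walk F k w (case_nat r c))))) \<partial>seq_space \<partial>unif)"
      by (rule nn_integral_seq_space) measurable
    also have "\<dots> = (\<integral>\<^sup>+r. (\<lambda>(w', e). ennreal (exp (- e)) * ennreal ((1 / 2) ^ n)) (F w r) \<partial>unif)"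
    proof (intro nn_integral_cong)
      fix r
      have "(\<integral>\<^sup>+c. ennreal (exp (- (\<Sum>k<Suc n. snd (walk F k w (case_nat r c))))) \<partial>seq_space) =
        (\<integral>\<^sup>+c. ennreal (exp (- snd (F w r))) * ennreal (exp (- (\<Sum>k<n. snd (walk F k (fst (F w r)) c)))) \<partial>seq_space)"
        by (subst sum.lessThan_Suc_shift) (simp add: ennreal_mult[symmetric] exp_add[symmetric])
      also have "\<dots> = ennreal (exp (- snd (F w r))) * ennreal ((1 / 2) ^ n)"
        by (subst nn_integral_cmult) (auto simp: Suc)
      finally show "(\<integral>\<^sup>+c. ennreal (exp (- (\<Sum>k<Suc n. snd (walk F k w (case_nat r c))))) \<partial>seq_space) =
         (\<lambda>(w', e). ennreal (exp (- e)) * ennreal ((1 / 2) ^ n)) (F w r)"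
        by (simp add: split_beta')
    qed
    also have "\<dots> = (\<integral>\<^sup>+w'. \<integral>\<^sup>+e. ennreal (exp (- e)) * ennreal ((1 / 2) ^ n) \<partial>expo \<partial>measure_pmf (J w))"
      by (subst nn_integral_sampler[OF F]) auto
    also have "(\<integral>\<^sup>+e. ennreal (exp (- e)) * ennreal ((1 / 2) ^ n) \<partial>expo) = ennreal ((1 / 2) ^ Suc n)"
      by (subst nn_integral_multc, simp, unfold nn_integral_expo_exp, subst ennreal_mult[symmetric]) auto
    also have "(\<integral>\<^sup>+w'. ennreal ((1 / 2) ^ Suc n) \<partial>measure_pmf (J w)) = ennreal ((1 / 2) ^ Suc n)"
      by (simp add: measure_pmf.emeasure_space_1[simplified])
    finally show ?case .
  qed
  define G where "G c = (INF n. ennreal (exp (- (\<Sum>k<n. snd (walk F k w c)))))" for c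
  have [measurable]: "G \<in> borel_measurable seq_space"
    unfolding G_def by measurable
  have "(\<integral>\<^sup>+c. G c \<partial>seq_space) \<le> ennreal ((1 / 2) ^ n)" for n
    unfolding int[of w, symmetric] G_def by (intro nn_integral_mono INF_lower) auto
  moreover have "(\<lambda>n. ennreal ((1 / 2) ^ n)) \<longlonglongrightarrow> ennreal 0"
    by (intro tendsto_ennrealI LIMSEQ_power_zero) auto
  ultimately have "(\<integral>\<^sup>+c. G c \<partial>seq_space) \<le> ennreal 0"
    by (intro LIMSEQ_le_const) auto
  then have "AE c in seq_space. G c = 0"
    by (simp add: nn_integral_0_iff_AE)
  then show ?thesis
  proof eventually_elim
    fix c assume G0: "G c = 0"
    show "\<not> summable (\<lambda>k. snd (walk F k w c))"
    proof
      assume sm: "summable (\<lambda>k. snd (walk F k w c))"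
      have "ennreal (exp (- (\<Sum>k. snd (walk F k w c)))) \<le> G c"
        unfolding G_def
        using pos by (intro INF_greatest ennreal_leI) (auto intro!: sum_le_suminf sm intro: less_imp_le)
      then show False using G0 by (simp)
    qed
  qed
qed

definition jump_path :: "'a \<Rightarrow> (nat \<Rightarrow> 'a) \<Rightarrow> (nat \<Rightarrow> ennreal) \<Rightarrow> real \<Rightarrow> 'a" where
  "jump_path x Z S t = (if \<exists>n. ennreal t < (\<Sum>k<Suc n. S k)
      then Z (LEAST n. ennreal t < (\<Sum>k<Suc n. S k)) else x)"

lemma jump_path_eq:
  assumes "(\<Sum>k<n. S k) \<le> ennreal t" "ennreal t < (\<Sum>k<Suc n. S k)"
  shows "jump_path x Z S t = Z n"
proof -
  have "(LEAST n. ennreal t < (\<Sum>k<Suc n. S k)) = n"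
  proof (rule Least_equality)
    fix m assume m: "ennreal t < (\<Sum>k<Suc m. S k)"
    show "n \<le> m"
    proof (rule ccontr)
      assume "\<not> n \<le> m"
      then have "(\<Sum>k<Suc m. S k) \<le> (\<Sum>k<n. S k)"
        by (intro sum_mono2) auto
      then show False using m assms(1) by simp
    qed
  qed fact
  then show ?thesis using assms(2) by (auto simp: jump_path_def)
qed

lemma ctmc_jump_path:
  fixes Z :: "nat \<Rightarrow> 'm \<Rightarrow> 'a :: countable"
  assumes [measurable]: "\<And>n. Z n \<in> measurable M (count_space UNIV)" "\<And>n. S n \<in> borel_measurable M"
    and E: "\<And>n \<omega>. \<omega> \<in> space M \<Longrightarrow> Z n \<omega> \<in> E" "x0 \<in> E"
    and law: "\<And>n z t. (\<And>k. k \<le> n \<Longrightarrow> z k \<in> E) \<Longrightarrow>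
        measure M {\<omega>\<in>space M. traj_event n z t (\<lambda>k. (Z k \<omega>, S k \<omega>))} =
        (if z 0 = x0 then 1 else 0) * traj_prob q n z t"
  shows "ctmc M E q x0 (\<lambda>t \<omega>. jump_path x0 (\<lambda>n. Z n \<omega>) (\<lambda>n. S n \<omega>) t)"
  unfolding ctmc_def
proof (intro conjI allI ballI impI exI[of _ Z] exI[of _ S])
  fix t
  have "(\<lambda>\<omega>. Z (LEAST n. ennreal t < (\<Sum>k<Suc n. S k \<omega>)) \<omega>) \<in> measurable M (count_space UNIV)"
    by (rule measurable_compose_countable) measurable
  then show "(\<lambda>\<omega>. jump_path x0 (\<lambda>n. Z n \<omega>) (\<lambda>n. S n \<omega>) t) \<in> measurable M (count_space UNIV)"
    unfolding jump_path_def by measurable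
next
  fix t \<omega> assume "\<omega> \<in> space M"
  then show "jump_path x0 (\<lambda>n. Z n \<omega>) (\<lambda>n. S n \<omega>) t \<in> E"
    using E by (simp add: jump_path_def)
next
  fix n :: nat and z :: "nat \<Rightarrow> 'a" and t :: "nat \<Rightarrow> real"
  assume z: "\<forall>k\<le>n. z k \<in> E" and t: "\<forall>k<n. 0 \<le> t k"
  have "measure M {\<omega>\<in>space M. (\<forall>k\<le>n. Z k \<omega> = z k) \<and> (\<forall>k<n. ennreal (t k) < S k \<omega>)} =
    (if z 0 = x0 then 1 else 0) * traj_prob q n z t"
    using law[of n z t] z by (simp add: traj_event_def)
  also have "traj_prob q n z t = (\<Prod>k<n. exp (- hold_rate q (z k) * t k) * jump_prob q (z k) (z (Suc k)))"
    unfolding traj_prob_def using t by (intro prod.cong) auto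
  finally show "measure M {\<omega>\<in>space M. (\<forall>k\<le>n. Z k \<omega> = z k) \<and> (\<forall>k<n. ennreal (t k) < S k \<omega>)} =
    (if z 0 = x0 then 1 else 0) * (\<Prod>k<n. exp (- hold_rate q (z k) * t k) * jump_prob q (z k) (z (Suc k)))" .
qed (auto simp: E intro: jump_path_eq)

section \<open>Projections of a chain and their truncations\<close>

lemma nn_integral_indicator_pmf:
  "(\<integral>\<^sup>+w. indicator {v} (f w) * C \<partial>measure_pmf p) = ennreal (pmf (map_pmf f p) v) * C"
proof -
  have "(\<integral>\<^sup>+w. indicator {v} (f w) * C \<partial>measure_pmf p) = (\<integral>\<^sup>+w. indicator (f -` {v}) w \<partial>measure_pmf p) * C"
    by (subst nn_integral_multc[symmetric]) (auto intro!: nn_integral_cong simp: indicator_def)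
  then show ?thesis
    by (simp add: pmf_map measure_pmf.emeasure_eq_measure)
qed

lemma pred_traj_event:
  assumes [measurable]: "\<And>m. (\<lambda>x. s x m) \<in> M \<rightarrow>\<^sub>M count_space UNIV \<Otimes>\<^sub>M borel"
  shows "Measurable.pred M (\<lambda>x. traj_event n z t (s x))"
proof -
  have [measurable]: "(\<lambda>x. fst (s x m)) \<in> M \<rightarrow>\<^sub>M count_space UNIV"
    "(\<lambda>x. snd (s x m)) \<in> M \<rightarrow>\<^sub>M borel" for m
    by measurable
  show ?thesis
    unfolding traj_event_def by measurable
qed

text \<open>A chain with total rate \<open>\<Lambda> w\<close> in \<open>w\<close>, null steps included, whose projection under \<open>f\<close> jumps
  with rates \<open>q\<close>. The kernel \<open>P\<close> drives a copy of the \<open>q\<close>-chain that takes over when the big chain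
  explodes while its projection has made only finitely many jumps.\<close>

locale lumped_chain =
  fixes E :: "'a :: countable set" and q :: "'a \<Rightarrow> 'a \<Rightarrow> real"
    and V :: "'w :: countable set" and f :: "'w \<Rightarrow> 'a" and \<Lambda> :: "'w \<Rightarrow> real"
    and J :: "'w \<Rightarrow> 'w pmf" and F :: "'w \<Rightarrow> real \<Rightarrow> 'w \<times> real"
    and P :: "'a \<Rightarrow> 'a pmf" and G :: "'a \<Rightarrow> real \<Rightarrow> 'a \<times> real"
  assumes rate: "rate_matrix E q"
    and F: "\<And>w. step_sampler (J w) (F w)"
    and G: "\<And>x. step_sampler (P x) (G x)"
    and V: "\<And>w. w \<in> V \<Longrightarrow> set_pmf (J w) \<subseteq> V"
    and f: "\<And>w. w \<in> V \<Longrightarrow> f w \<in> E"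
    and P: "\<And>x. x \<in> E \<Longrightarrow> set_pmf (P x) \<subseteq> E"
    and pmf_P: "\<And>x z. x \<in> E \<Longrightarrow> z \<in> E \<Longrightarrow> pmf (P x) z = jump_prob q x z"
    and hold_less: "\<And>w. w \<in> V \<Longrightarrow> hold_rate q (f w) < \<Lambda> w"
    and lump_jump: "\<And>w z. w \<in> V \<Longrightarrow> z \<in> E \<Longrightarrow> z \<noteq> f w \<Longrightarrow>
          pmf (map_pmf f (J w)) z = q (f w) z / \<Lambda> w"
    and lump_stay: "\<And>w. w \<in> V \<Longrightarrow> pmf (map_pmf f (J w)) (f w) = 1 - hold_rate q (f w) / \<Lambda> w"
begin

lemma F_measurable [measurable]: "F w \<in> unif \<rightarrow>\<^sub>M count_space UNIV \<Otimes>\<^sub>M borel"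
  using F by (simp add: step_sampler_def)

lemma G_measurable [measurable]: "G x \<in> unif \<rightarrow>\<^sub>M count_space UNIV \<Otimes>\<^sub>M borel"
  using G by (simp add: step_sampler_def)

lemma F_in: "w \<in> V \<Longrightarrow> fst (F w r) \<in> V" and F_pos: "0 < snd (F w r)"
  using F[of w] V[of w] by (auto simp: step_sampler_def mem_Times_iff)

lemma G_in: "x \<in> E \<Longrightarrow> fst (G x r) \<in> E" and G_pos: "0 < snd (G x r)"
  using G[of x] P[of x] by (auto simp: step_sampler_def mem_Times_iff)

lemma \<Lambda>_pos: "w \<in> V \<Longrightarrow> 0 < \<Lambda> w"
  using hold_less[of w] hold_rate_nonneg[OF rate f[of w]] by simp

definition fresh :: "'a \<Rightarrow> (nat \<Rightarrow> real) \<Rightarrow> nat \<Rightarrow> 'a \<times> ennreal" where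
  "fresh x g m = (fst (walk G m x g), ennreal (snd (walk G m x g)) / ennreal (hold_rate q (fst (walk G m x g))))"

text \<open>Follow the big chain for \<open>N\<close> steps and the fresh chain afterwards. The fresh randomness \<open>g\<close> is
  the same for every \<open>N\<close>, which makes these trajectories converge pointwise as \<open>N\<close> grows.\<close>

primrec apx :: "nat \<Rightarrow> 'w \<Rightarrow> (nat \<Rightarrow> real) \<Rightarrow> (nat \<Rightarrow> real) \<Rightarrow> nat \<Rightarrow> 'a \<times> ennreal" where
  "apx 0 w c g = fresh (f w) g"
| "apx (Suc N) w c g = attach (f w) (f (fst (F w (c 0)))) (ennreal (snd (F w (c 0)) / \<Lambda> w))
     (apx N (fst (F w (c 0))) (\<lambda>n. c (Suc n)) g)"

lemma fresh_measurable [measurable]: "(\<lambda>g. fresh x g m) \<in> seq_space \<rightarrow>\<^sub>M count_space UNIV \<Otimes>\<^sub>M borel"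
  unfolding fresh_def by measurable

lemma fresh_in: "x \<in> E \<Longrightarrow> fst (fresh x g m) \<in> E" and fresh_pos: "x \<in> E \<Longrightarrow> 0 < snd (fresh x g m)"
  using walk_in[OF G P, where k = m and c = g]
  by (auto simp: fresh_def ennreal_zero_less_divide)

lemma attach_measurable [measurable]:
  assumes [measurable]: "h \<in> borel_measurable M" "\<And>m. (\<lambda>x. s x m) \<in> M \<rightarrow>\<^sub>M count_space UNIV \<Otimes>\<^sub>M borel"
  shows "(\<lambda>x. attach a b (h x) (s x) m) \<in> M \<rightarrow>\<^sub>M count_space UNIV \<Otimes>\<^sub>M borel"
proof (cases "a = b")
  case True
  then show ?thesis by (cases "m = 0") (simp_all add: attach_def)
next
  case False
  then show ?thesis by (cases m) (simp_all add: attach_def)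
qed

lemma apx_measurable [measurable]:
  "(\<lambda>x. apx N w (fst x) (snd x) m) \<in> seq_space \<Otimes>\<^sub>M seq_space \<rightarrow>\<^sub>M count_space UNIV \<Otimes>\<^sub>M borel"
proof (induction N arbitrary: w m)
  case 0
  then show ?case by simp
next
  case (Suc N)
  have [measurable]: "(\<lambda>x. apx N w (\<lambda>n. fst x (Suc n)) (snd x) m) \<in>
      seq_space \<Otimes>\<^sub>M seq_space \<rightarrow>\<^sub>M count_space UNIV \<Otimes>\<^sub>M borel" for w m
    by (rule measurable_compose[of "\<lambda>x. (\<lambda>n. fst x (Suc n), snd x)", OF _ Suc, simplified]) measurable
  have "(\<lambda>x. attach (f w) (f (fst (F w (fst x 0)))) (ennreal (snd (F w (fst x 0)) / \<Lambda> w))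
     (apx N (fst (F w (fst x 0))) (\<lambda>n. fst x (Suc n)) (snd x)) m) \<in>
      seq_space \<Otimes>\<^sub>M seq_space \<rightarrow>\<^sub>M count_space UNIV \<Otimes>\<^sub>M borel"
    by (rule measurable_compose_countable[where f = "\<lambda>w' x. attach (f w) (f w') (ennreal (snd (F w (fst x 0)) / \<Lambda> w))
     (apx N w' (\<lambda>n. fst x (Suc n)) (snd x)) m"]) measurable
  then show ?case by simp
qed

lemma apx_start: "fst (apx N w c g 0) = f w"
  by (induction N arbitrary: w c) (auto simp: fresh_def attach_def)

lemma apx_in:
  assumes "w \<in> V"
  shows "fst (apx N w c g m) \<in> E" "0 < snd (apx N w c g m)"
proof -
  have "fst (apx N w c g m) \<in> E \<and> 0 < snd (apx N w c g m)"
    using assms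
  proof (induction N arbitrary: w c m)
    case 0
    then show ?case using fresh_in fresh_pos f by simp
  next
    case (Suc N)
    then show ?case
      using Suc.IH[OF F_in[OF Suc.prems]] f \<Lambda>_pos F_pos
      by (auto simp: attach_def ennreal_zero_less_divide add_pos_pos split: nat.split)
  qed
  then show "fst (apx N w c g m) \<in> E" "0 < snd (apx N w c g m)" by auto
qed

lemma jump_prob_nonneg: "x \<in> E \<Longrightarrow> z \<in> E \<Longrightarrow> 0 \<le> jump_prob q x z"
  using pmf_P[of x z] by (metis pmf_nonneg)

lemma fresh_law:
  assumes "x \<in> E" "\<And>k. k \<le> n \<Longrightarrow> z k \<in> E"
  shows "(\<integral>\<^sup>+g. indicator {g. traj_event n z t (fresh x g)} g \<partial>seq_space) =
    ennreal ((if z 0 = x then 1 else 0) * traj_prob q n z t)"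
  using assms
proof (induction n arbitrary: x z t)
  case 0
  interpret seq: prob_space seq_space by (rule prob_space_seq_space)
  show ?case
    by (auto simp: traj_event_0 fresh_def traj_prob_def seq.emeasure_space_1)
next
  case (Suc n)
  let ?z = "\<lambda>k. z (Suc k)" and ?t = "\<lambda>k. t (Suc k)"
  let ?Q = "traj_prob q n ?z ?t" and ?l = "hold_rate q x"
  have l: "0 \<le> ?l" using hold_rate_nonneg[OF rate Suc.prems(1)] .
  have [measurable]: "Measurable.pred seq_space (\<lambda>g. traj_event n z t (fresh x g))" for x n z t
    by (rule pred_traj_event) measurable
  define \<phi> where "\<phi> = (\<lambda>(x', e::real). (if z 0 = x then 1 else 0) *
      (indicator {e. ?l * t 0 < e} e * (indicator {z 1} x' * ennreal ?Q)))"
  have [measurable]: "\<phi> \<in> borel_measurable (count_space UNIV \<Otimes>\<^sub>M borel)"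
    unfolding \<phi>_def by measurable
  have "(\<integral>\<^sup>+g. indicator {g. traj_event (Suc n) z t (fresh x g)} g \<partial>seq_space) =
     (\<integral>\<^sup>+r. \<integral>\<^sup>+g. indicator {g. traj_event (Suc n) z t (fresh x g)} (case_nat r g) \<partial>seq_space \<partial>unif)"
    by (rule nn_integral_seq_space) measurable
  also have "\<dots> = (\<integral>\<^sup>+r. \<phi> (G x r) \<partial>unif)"
  proof (rule nn_integral_cong)
    fix r
    obtain x' e where Gr: "G x r = (x', e)" by (cases "G x r")
    then have x': "x' \<in> E" and e: "0 < e"
      using G_in[OF Suc.prems(1), of r] G_pos[of x r] by auto
    have less: "ennreal (t 0) < ennreal e / ennreal ?l \<longleftrightarrow> ?l * t 0 < e"
    proof (cases "?l = 0")
      case True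
      then show ?thesis using e by (simp add: ennreal_divide_zero)
    next
      case False
      then have "0 < ?l" using l by simp
      then show ?thesis using e
        by (simp add: divide_ennreal ennreal_less_ennreal_pos pos_less_divide_eq mult.commute)
    qed
    have "traj_event (Suc n) z t (fresh x (case_nat r g)) \<longleftrightarrow>
        z 0 = x \<and> ?l * t 0 < e \<and> traj_event n ?z ?t (fresh x' g)" for g
    proof -
      have "(\<lambda>k. fresh x (case_nat r g) (Suc k)) = fresh x' g"
        by (simp add: fun_eq_iff fresh_def Gr)
      then show ?thesis
        unfolding traj_event_Suc less[symmetric] by (auto simp: fresh_def Gr)
    qed
    then have "(\<integral>\<^sup>+g. indicator {g. traj_event (Suc n) z t (fresh x g)} (case_nat r g) \<partial>seq_space) =
      (\<integral>\<^sup>+g. ((if z 0 = x then 1 else 0) * indicator {e. ?l * t 0 < e} e) *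
         indicator {g. traj_event n ?z ?t (fresh x' g)} g \<partial>seq_space)"
      by (intro nn_integral_cong) (auto simp: indicator_def)
    also have "\<dots> = ((if z 0 = x then 1 else 0) * indicator {e. ?l * t 0 < e} e) *
      (\<integral>\<^sup>+g. indicator {g. traj_event n ?z ?t (fresh x' g)} g \<partial>seq_space)"
      by (rule nn_integral_cmult) measurable
    also have "\<dots> = \<phi> (G x r)"
      using Suc.IH[OF x', of ?z ?t] Suc.prems(2)
      by (simp add: \<phi>_def Gr indicator_def)
    finally show "(\<integral>\<^sup>+g. indicator {g. traj_event (Suc n) z t (fresh x g)} (case_nat r g) \<partial>seq_space) = \<phi> (G x r)" .
  qed
  also have "\<dots> = (\<integral>\<^sup>+x'. \<integral>\<^sup>+e. \<phi> (x', e) \<partial>expo \<partial>measure_pmf (P x))"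
    by (rule nn_integral_sampler[OF G]) measurable
  also have "\<dots> = (\<integral>\<^sup>+x'. indicator {z 1} x' * ((if z 0 = x then 1 else 0) * ennreal (exp (- (?l * max 0 (t 0)))) * ennreal ?Q) \<partial>measure_pmf (P x))"
  proof (rule nn_integral_cong)
    fix x'
    have "(\<integral>\<^sup>+e. \<phi> (x', e) \<partial>expo) = (\<integral>\<^sup>+e. ((if z 0 = x then 1 else 0) * (indicator {z 1} x' * ennreal ?Q)) * indicator {e. ?l * t 0 < e} e \<partial>expo)"
      unfolding \<phi>_def by (intro nn_integral_cong) (simp add: ac_simps)
    also have "\<dots> = ((if z 0 = x then 1 else 0) * (indicator {z 1} x' * ennreal ?Q)) * ennreal (exp (- (?l * max 0 (t 0))))"
      by (subst nn_integral_cmult) (auto simp only: nn_integral_expo_greater[OF l], measurable)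
    finally show "(\<integral>\<^sup>+e. \<phi> (x', e) \<partial>expo) = indicator {z 1} x' * ((if z 0 = x then 1 else 0) * ennreal (exp (- (?l * max 0 (t 0)))) * ennreal ?Q)"
      by (simp add: ac_simps)
  qed
  also have "\<dots> = ennreal (jump_prob q x (z 1)) * ((if z 0 = x then 1 else 0) * ennreal (exp (- (?l * max 0 (t 0)))) * ennreal ?Q)"
    using nn_integral_indicator_pmf[where v = "z 1" and f = "\<lambda>x. x" and p = "P x"] pmf_P[OF Suc.prems(1), of "z 1"] Suc.prems(2)[of 1]
    by simp
  also have "\<dots> = ennreal ((if z 0 = x then 1 else 0) * traj_prob q (Suc n) z t)"
  proof -
    have "0 \<le> jump_prob q x (z 1)"
      using Suc.prems by (intro jump_prob_nonneg) auto
    then show ?thesis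
      by (auto simp: traj_prob_Suc ennreal_mult''[symmetric] ennreal_mult'[symmetric] ac_simps)
  qed
  finally show ?case .
qed

lemma traj_prob_nonneg:
  assumes "\<And>k. k \<le> n \<Longrightarrow> z k \<in> E"
  shows "0 \<le> traj_prob q n z t"
  unfolding traj_prob_def using assms by (intro prod_nonneg) (auto intro!: mult_nonneg_nonneg jump_prob_nonneg)

text \<open>With \<open>l = hold_rate q (f w)\<close>, this is the identity
  \<open>(1 - l/\<Lambda>) E[exp (- l (t - e/\<Lambda>)\<^sup>+)] + (l/\<Lambda>) P(e/\<Lambda> > t) = exp (- l t)\<close> for \<open>e\<close> exponential,
  multiplied by the probability that the lumped chain jumps to \<open>y\<close>.\<close>

lemma first_step_identity:
  assumes "w \<in> V" "y \<in> E" "0 \<le> t"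
  defines "l \<equiv> hold_rate q (f w)"
  shows "(1 - l / \<Lambda> w) * ((exp (- (l / \<Lambda> w * (\<Lambda> w * t))) - l / \<Lambda> w * exp (- (\<Lambda> w * t))) / (1 - l / \<Lambda> w) * jump_prob q (f w) y) +
    (if y = f w then 0 else q (f w) y / \<Lambda> w) * exp (- (\<Lambda> w * t)) = exp (- (l * t)) * jump_prob q (f w) y"
proof -
  have \<Lambda>: "0 < \<Lambda> w" "l < \<Lambda> w" using \<Lambda>_pos hold_less assms by auto
  then have "1 - l / \<Lambda> w \<noteq> 0" by simp
  then have "(1 - l / \<Lambda> w) * ((exp (- (l / \<Lambda> w * (\<Lambda> w * t))) - l / \<Lambda> w * exp (- (\<Lambda> w * t))) / (1 - l / \<Lambda> w) * jump_prob q (f w) y) =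
    (exp (- (l * t)) - l / \<Lambda> w * exp (- (\<Lambda> w * t))) * jump_prob q (f w) y"
    using \<Lambda> by simp
  moreover have "(if y = f w then 0 else q (f w) y / \<Lambda> w) = l / \<Lambda> w * jump_prob q (f w) y"
  proof (cases "y = f w")
    case True
    then show ?thesis by (simp add: jump_prob_def l_def)
  next
    case False
    then show ?thesis
      using rate_eq_hold_rate_times_jump_prob[OF rate f[OF assms(1)] assms(2) False] by (simp add: l_def)
  qed
  ultimately show ?thesis by (simp add: algebra_simps)
qed

lemma apx_law:
  assumes "w \<in> V" "\<And>k. k \<le> n \<Longrightarrow> z k \<in> E"
  shows "(\<integral>\<^sup>+c. \<integral>\<^sup>+g. indicator {g. traj_event n z t (apx N w c g)} g \<partial>seq_space \<partial>seq_space) =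
    ennreal ((if z 0 = f w then 1 else 0) * traj_prob q n z t)"
  using assms
proof (induction N arbitrary: w n z t)
  case 0
  interpret seq: prob_space seq_space by (rule prob_space_seq_space)
  show ?case
    using fresh_law[OF f[OF 0(1)] 0(2)] by (simp add: seq.emeasure_space_1)
next
  case (Suc N)
  interpret seq: prob_space seq_space by (rule prob_space_seq_space)
  show ?case
  proof (cases n)
    case 0
    then show ?thesis
      by (simp only: traj_event_0 apx_start) (auto simp: traj_prob_def seq.emeasure_space_1)
  next
    case (Suc m)
    let ?z = "\<lambda>k. z (Suc k)" and ?t = "\<lambda>k. t (Suc k)"
    let ?Q = "traj_prob q m ?z ?t" and ?a = "hold_rate q (f w) / \<Lambda> w" and ?\<tau> = "\<Lambda> w * max 0 (t 0)"
    let ?j = "jump_prob q (f w) (z 1)"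
    let ?C1 = "ennreal ((exp (- (?a * ?\<tau>)) - ?a * exp (- ?\<tau>)) / (1 - ?a)) * ennreal (?j * ?Q)"
    let ?C2 = "ennreal (exp (- ?\<tau>)) * ennreal ?Q"
    have \<Lambda>: "0 < \<Lambda> w" using \<Lambda>_pos Suc.prems by auto
    have a: "0 \<le> ?a" "?a < 1"
      using hold_rate_nonneg[OF rate f] hold_less Suc.prems(1) \<Lambda> by auto
    have z1: "z 1 \<in> E" using Suc.prems(2)[of 1] Suc by simp
    have Q: "0 \<le> ?Q" using Suc.prems(2) Suc by (intro traj_prob_nonneg) auto
    have j: "0 \<le> ?j" using z1 f Suc.prems(1) by (intro jump_prob_nonneg)
    have [measurable]: "Measurable.pred (seq_space \<Otimes>\<^sub>M seq_space) (\<lambda>x. traj_event n z t (apx N w (fst x) (snd x)))" for N n z t w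
      by (rule pred_traj_event) measurable
    have meas [measurable]: "Measurable.pred seq_space (\<lambda>g. traj_event n z t (apx N w c g))" if "c \<in> space seq_space" for N n z t w c
      using measurable_Pair2[OF _ that, of "\<lambda>x. traj_event n z t (apx N w (fst x) (snd x))"] by simp
    define \<phi> where "\<phi> = (\<lambda>(w', e). (if z 0 = f w then 1 else 0) *
      (if f w' = f w then ennreal (exp (- (?a * max 0 (?\<tau> - e)))) * ennreal (?j * ?Q)
       else indicator {e. \<Lambda> w * t 0 < e} e * (indicator {z 1} (f w') * ennreal ?Q)))"
    have [measurable]: "\<phi> \<in> borel_measurable (count_space UNIV \<Otimes>\<^sub>M borel)"
      unfolding \<phi>_def by measurable
    have "(\<integral>\<^sup>+c. \<integral>\<^sup>+g. indicator {g. traj_event n z t (apx (Suc N) w c g)} g \<partial>seq_space \<partial>seq_space) =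
      (\<integral>\<^sup>+r. \<integral>\<^sup>+c. \<integral>\<^sup>+g. indicator {g. traj_event n z t (apx (Suc N) w (case_nat r c) g)} g \<partial>seq_space \<partial>seq_space \<partial>unif)"
    proof (rule nn_integral_seq_space)
      have "(\<lambda>c. \<integral>\<^sup>+g. indicator {x. traj_event n z t (apx (Suc N) w (fst x) (snd x))} (c, g) \<partial>seq_space) \<in> borel_measurable seq_space"
        by measurable
      then show "(\<lambda>c. \<integral>\<^sup>+g. indicator {g. traj_event n z t (apx (Suc N) w c g)} g \<partial>seq_space) \<in> borel_measurable seq_space"
        by (simp add: indicator_def)
    qed
    also have "\<dots> = (\<integral>\<^sup>+r. \<phi> (F w r) \<partial>unif)"
    proof (rule nn_integral_cong)
      fix r
      obtain w' e where Fr: "F w r = (w', e)" by (cases "F w r")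
      then have w': "w' \<in> V" and e: "0 < e"
        using F_in[OF Suc.prems(1), of r] F_pos[of w r] by auto
      have eq: "apx (Suc N) w (case_nat r c) g = attach (f w) (f w') (ennreal (e / \<Lambda> w)) (apx N w' c g)" for c g
        by (simp add: Fr)
      show "(\<integral>\<^sup>+c. \<integral>\<^sup>+g. indicator {g. traj_event n z t (apx (Suc N) w (case_nat r c) g)} g \<partial>seq_space \<partial>seq_space) = \<phi> (F w r)"
      proof (cases "f w' = f w")
        case True
        have "(\<integral>\<^sup>+c. \<integral>\<^sup>+g. indicator {g. traj_event n z t (apx (Suc N) w (case_nat r c) g)} g \<partial>seq_space \<partial>seq_space) =
          (\<integral>\<^sup>+c. \<integral>\<^sup>+g. indicator {g. traj_event n z (t(0 := t 0 - e / \<Lambda> w)) (apx N w' c g)} g \<partial>seq_space \<partial>seq_space)"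
          unfolding eq True Suc
          by (subst traj_event_attach_same) (auto simp: \<Lambda> e apx_in[OF w'])
        also have "\<dots> = ennreal ((if z 0 = f w then 1 else 0) * traj_prob q n z (t(0 := t 0 - e / \<Lambda> w)))"
          unfolding True[symmetric] by (rule Suc.IH[OF w' Suc.prems(2)])
        also have "\<dots> = \<phi> (F w r)"
        proof -
          have "hold_rate q (f w) * max 0 (t 0 - e / \<Lambda> w) = ?a * max 0 (?\<tau> - e)"
          proof (cases "0 \<le> t 0")
            case True
            then have "\<Lambda> w * max 0 (t 0 - e / \<Lambda> w) = max 0 (?\<tau> - e)"
              using \<Lambda> by (auto simp: max_def field_simps)
            then show ?thesis using \<Lambda> by (metis (no_types, lifting) less_irrefl mult.assoc nonzero_eq_divide_eq)
          next
            case False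
            then have "t 0 - e / \<Lambda> w \<le> 0" using e \<Lambda> by (smt (verit) divide_pos_pos)
            then show ?thesis using False e by (simp add: max_def)
          qed
          then show ?thesis
            using j Q True unfolding Suc by (auto simp: \<phi>_def Fr traj_prob_Suc ennreal_mult[symmetric] ac_simps)
        qed
        finally show ?thesis .
      next
        case False
        have less: "ennreal (t 0) < ennreal (e / \<Lambda> w) \<longleftrightarrow> \<Lambda> w * t 0 < e"
          using \<Lambda> e by (simp add: ennreal_less_ennreal_pos pos_less_divide_eq mult.commute)
        have "(\<integral>\<^sup>+c. \<integral>\<^sup>+g. indicator {g. traj_event n z t (apx (Suc N) w (case_nat r c) g)} g \<partial>seq_space \<partial>seq_space) =
          (\<integral>\<^sup>+c. \<integral>\<^sup>+g. ((if z 0 = f w then 1 else 0) * indicator {e. \<Lambda> w * t 0 < e} e) *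
             indicator {g. traj_event m ?z ?t (apx N w' c g)} g \<partial>seq_space \<partial>seq_space)"
          unfolding eq Suc traj_event_attach_diff[OF False[symmetric]] less
          by (intro nn_integral_cong) (auto simp: indicator_def)
        also have "\<dots> = (\<integral>\<^sup>+c. ((if z 0 = f w then 1 else 0) * indicator {e. \<Lambda> w * t 0 < e} e) *
            (\<integral>\<^sup>+g. indicator {g. traj_event m ?z ?t (apx N w' c g)} g \<partial>seq_space) \<partial>seq_space)"
          using meas by (intro nn_integral_cong nn_integral_cmult) auto
        also have "\<dots> = ((if z 0 = f w then 1 else 0) * indicator {e. \<Lambda> w * t 0 < e} e) *
            (\<integral>\<^sup>+c. \<integral>\<^sup>+g. indicator {g. traj_event m ?z ?t (apx N w' c g)} g \<partial>seq_space \<partial>seq_space)"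
        proof (rule nn_integral_cmult)
          have "(\<lambda>c. \<integral>\<^sup>+g. indicator {x. traj_event m ?z ?t (apx N w' (fst x) (snd x))} (c, g) \<partial>seq_space) \<in> borel_measurable seq_space"
            by measurable
          then show "(\<lambda>c. \<integral>\<^sup>+g. indicator {g. traj_event m ?z ?t (apx N w' c g)} g \<partial>seq_space) \<in> borel_measurable seq_space"
            by (simp add: indicator_def)
        qed
        also have "\<dots> = \<phi> (F w r)"
          using Suc.IH[OF w', of m ?z ?t] Suc.prems(2) False
          by (simp add: Suc \<phi>_def Fr indicator_def)
        finally show ?thesis .
      qed
    qed
    also have "\<dots> = (\<integral>\<^sup>+w'. \<integral>\<^sup>+e. \<phi> (w', e) \<partial>expo \<partial>measure_pmf (J w))"
      by (rule nn_integral_sampler[OF F]) measurable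
    also have "\<dots> = (\<integral>\<^sup>+w'. indicator {f w} (f w') * ((if z 0 = f w then 1 else 0) * ?C1) +
        indicator {z 1} (f w') * ((if z 0 = f w then 1 else 0) * (if z 1 = f w then 0 else ?C2)) \<partial>measure_pmf (J w))"
    proof (rule nn_integral_cong)
      fix w'
      let ?i = "if z 0 = f w then 1 else 0 :: ennreal"
      show "(\<integral>\<^sup>+e. \<phi> (w', e) \<partial>expo) = indicator {f w} (f w') * (?i * ?C1) +
        indicator {z 1} (f w') * (?i * (if z 1 = f w then 0 else ?C2))"
      proof (cases "f w' = f w")
        case True
        have "(\<integral>\<^sup>+e. \<phi> (w', e) \<partial>expo) = (\<integral>\<^sup>+e. (?i * ennreal (?j * ?Q)) * ennreal (exp (- (?a * max 0 (?\<tau> - e)))) \<partial>expo)"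
          using True unfolding \<phi>_def by (intro nn_integral_cong) (simp add: ac_simps)
        also have "\<dots> = (?i * ennreal (?j * ?Q)) * (\<integral>\<^sup>+e. ennreal (exp (- (?a * max 0 (?\<tau> - e)))) \<partial>expo)"
          by (rule nn_integral_cmult) measurable
        also have "\<dots> = ?i * ?C1"
          using \<Lambda> by (subst nn_integral_expo_exp_max[OF a]) (auto simp: ac_simps)
        finally show ?thesis using True by (auto simp: indicator_def)
      next
        case False
        have "(\<integral>\<^sup>+e. \<phi> (w', e) \<partial>expo) = (\<integral>\<^sup>+e. (?i * (indicator {z 1} (f w') * ennreal ?Q)) * indicator {e. \<Lambda> w * t 0 < e} e \<partial>expo)"
          using False unfolding \<phi>_def by (intro nn_integral_cong) (simp add: ac_simps)
        also have "\<dots> = (?i * (indicator {z 1} (f w') * ennreal ?Q)) * (\<integral>\<^sup>+e. indicator {e. \<Lambda> w * t 0 < e} e \<partial>expo)"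
          by (rule nn_integral_cmult) measurable
        also have "\<dots> = (?i * (indicator {z 1} (f w') * ennreal ?Q)) * ennreal (exp (- ?\<tau>))"
          using \<Lambda> by (subst nn_integral_expo_greater) auto
        finally show ?thesis using False by (auto simp: indicator_def ac_simps)
      qed
    qed
    also have "\<dots> = ennreal (1 - ?a) * ((if z 0 = f w then 1 else 0) * ?C1) +
        ennreal (if z 1 = f w then 0 else q (f w) (z 1) / \<Lambda> w) * ((if z 0 = f w then 1 else 0) * ?C2)"
      using lump_stay[OF Suc.prems(1)] lump_jump[OF Suc.prems(1) z1]
      by (subst nn_integral_add) (simp_all add: nn_integral_indicator_pmf)
    also have "\<dots> = ennreal ((if z 0 = f w then 1 else 0) * traj_prob q n z t)"
    proof (cases "z 0 = f w")
      case True
      let ?K = "(exp (- (?a * ?\<tau>)) - ?a * exp (- ?\<tau>)) / (1 - ?a)"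
      have "0 \<le> (if z 1 = f w then 0 else q (f w) (z 1) / \<Lambda> w)"
        using lump_jump[OF Suc.prems(1) z1] by (metis pmf_nonneg order_refl)
      moreover have "0 \<le> ?K"
      proof (rule divide_nonneg_nonneg)
        have "0 \<le> ?\<tau>" using \<Lambda> by simp
        then have "?a * exp (- ?\<tau>) \<le> 1 * exp (- ?\<tau>)" "?a * ?\<tau> \<le> 1 * ?\<tau>"
          using a by (intro mult_right_mono; simp)+
        then have "?a * exp (- ?\<tau>) \<le> exp (- ?\<tau>)" "exp (- ?\<tau>) \<le> exp (- (?a * ?\<tau>))" by simp_all
        then show "0 \<le> exp (- (?a * ?\<tau>)) - ?a * exp (- ?\<tau>)" by linarith
      qed (use a in simp)
      ultimately have "ennreal (1 - ?a) * ?C1 + ennreal (if z 1 = f w then 0 else q (f w) (z 1) / \<Lambda> w) * ?C2 =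
         ennreal ((1 - ?a) * (?K * (?j * ?Q)) + (if z 1 = f w then 0 else q (f w) (z 1) / \<Lambda> w) * (exp (- ?\<tau>) * ?Q))"
        using a j Q by (subst ennreal_plus) (simp_all only: ennreal_mult mult_nonneg_nonneg diff_ge_0_iff_ge less_imp_le exp_ge_zero)
      also have "(1 - ?a) * (?K * (?j * ?Q)) + (if z 1 = f w then 0 else q (f w) (z 1) / \<Lambda> w) * (exp (- ?\<tau>) * ?Q) =
         ((1 - ?a) * (?K * ?j) + (if z 1 = f w then 0 else q (f w) (z 1) / \<Lambda> w) * exp (- ?\<tau>)) * ?Q"
        by (simp only: distrib_right mult.assoc)
      also have "\<dots> = traj_prob q n z t"
        unfolding Suc traj_prob_Suc True using first_step_identity[OF Suc.prems(1) z1, of "max 0 (t 0)"] by simp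
      finally show ?thesis using True by simp
    qed simp
    finally show ?thesis .
  qed
qed

end

section \<open>Convergence of the truncations\<close>

lemma sum_attach_same:
  "(\<Sum>i<Suc m. snd (attach x x h s i)) = h + (\<Sum>i<Suc m. snd (s i))"
  by (simp only: sum.lessThan_Suc_shift) (simp add: attach_def ac_simps)

lemma sum_attach_diff:
  "x \<noteq> y \<Longrightarrow> (\<Sum>i<Suc m. snd (attach x y h s i)) = h + (\<Sum>i<m. snd (s i))"
  by (simp only: sum.lessThan_Suc_shift) (simp add: attach_def)

definition hold_time :: "('w \<Rightarrow> real \<Rightarrow> 'w \<times> real) \<Rightarrow> ('w \<Rightarrow> real) \<Rightarrow> 'w \<Rightarrow> (nat \<Rightarrow> real) \<Rightarrow> nat \<Rightarrow> real" where
  "hold_time F \<Lambda> w c k = snd (walk F k w c) / \<Lambda> (fst (walk F k w c))"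

context lumped_chain
begin

primrec jumps :: "nat \<Rightarrow> 'w \<Rightarrow> (nat \<Rightarrow> real) \<Rightarrow> nat" where
  "jumps 0 w c = 0"
| "jumps (Suc N) w c = (if f w = f (fst (F w (c 0))) then 0 else 1) +
     jumps N (fst (F w (c 0))) (\<lambda>n. c (Suc n))"

lemma jumps_le_Suc: "jumps N w c \<le> jumps (Suc N) w c"
proof (induction N arbitrary: w c)
  case (Suc N)
  show ?case using Suc[of "fst (F w (c 0))" "\<lambda>n. c (Suc n)"] by simp
qed simp

lemma apx_Suc_frozen:
  "m < jumps N w c \<Longrightarrow> apx (Suc N) w c g m = apx N w c g m"
proof (induction N arbitrary: w c m)
  case (Suc N)
  let ?w = "fst (F w (c 0))" and ?c = "\<lambda>n. c (Suc n)"
  have step: "apx (Suc M) w c g =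
      attach (f w) (f ?w) (ennreal (snd (F w (c 0)) / \<Lambda> w)) (apx M ?w ?c g)" for M
    by simp
  have IH: "k < jumps N ?w ?c \<Longrightarrow> apx (Suc N) ?w ?c g k = apx N ?w ?c g k" for k
    by (rule Suc.IH)
  show ?case
  proof (cases "f w = f ?w")
    case True
    then have "m < jumps N ?w ?c" using Suc.prems by simp
    then show ?thesis unfolding step[of "Suc N"] step[of N]
      using True IH[of m] by (auto simp add: attach_def simp del: apx.simps)
  next
    case False
    then show ?thesis unfolding step[of "Suc N"] step[of N]
      using Suc.prems IH by (cases m) (simp_all add: attach_def del: apx.simps)
  qed
qed simp

lemma apx_Suc_mono:
  "jumps (Suc N) w c = jumps N w c \<Longrightarrow>
     fst (apx (Suc N) w c g m) = fst (apx N w c g m) \<and> snd (apx N w c g m) \<le> snd (apx (Suc N) w c g m)"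
proof (induction N arbitrary: w c m)
  case 0
  then show ?case by (auto simp: attach_def split: if_splits)
next
  case (Suc N)
  let ?w = "fst (F w (c 0))" and ?c = "\<lambda>n. c (Suc n)"
  have step: "apx (Suc M) w c g =
      attach (f w) (f ?w) (ennreal (snd (F w (c 0)) / \<Lambda> w)) (apx M ?w ?c g)" for M
    by simp
  have "jumps (Suc N) ?w ?c = jumps N ?w ?c" using Suc.prems by simp
  note IH = Suc.IH[OF this]
  show ?case
  proof (cases "f w = f ?w")
    case True
    then show ?thesis unfolding step[of "Suc N"] step[of N]
      using IH[of m] by (auto simp: attach_def intro: add_left_mono simp del: apx.simps)
  next
    case False
    then show ?thesis unfolding step[of "Suc N"] step[of N]
      using IH[of "m - 1"] by (cases m) (simp_all add: attach_def del: apx.simps)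
  qed
qed

lemma apx_eventually_mono:
  "\<exists>N0. \<forall>N\<ge>N0. fst (apx (Suc N) w c g m) = fst (apx N w c g m) \<and>
      snd (apx N w c g m) \<le> snd (apx (Suc N) w c g m)"
proof (cases "\<exists>N. m < jumps N w c")
  case True
  then obtain N0 where N0: "m < jumps N0 w c" by blast
  have "m < jumps N w c" if "N0 \<le> N" for N
    using N0 lift_Suc_mono_le[of "\<lambda>N. jumps N w c", OF jumps_le_Suc that] by simp
  then show ?thesis using apx_Suc_frozen by (intro exI[of _ N0]) (simp del: apx.simps)
next
  case False
  then have "range (\<lambda>N. jumps N w c) \<subseteq> {..m}" by (auto simp: not_less)
  then have fin: "finite (range (\<lambda>N. jumps N w c))" by (rule finite_subset) simp
  then have "Max (range (\<lambda>N. jumps N w c)) \<in> range (\<lambda>N. jumps N w c)" by (rule Max_in) simp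
  then obtain N0 where N0: "jumps N0 w c = Max (range (\<lambda>N. jumps N w c))" by auto
  have "jumps N w c = jumps N0 w c" if "N0 \<le> N" for N
  proof (rule antisym)
    show "jumps N w c \<le> jumps N0 w c" unfolding N0 using fin by (intro Max_ge) auto
    show "jumps N0 w c \<le> jumps N w c"
      by (rule lift_Suc_mono_le[of "\<lambda>N. jumps N w c", OF jumps_le_Suc that])
  qed
  then have "jumps (Suc N) w c = jumps N w c" if "N0 \<le> N" for N
    using that le_SucI by metis
  then show ?thesis using apx_Suc_mono by (intro exI[of _ N0]) blast
qed

definition limZ :: "'w \<Rightarrow> (nat \<Rightarrow> real) \<Rightarrow> (nat \<Rightarrow> real) \<Rightarrow> nat \<Rightarrow> 'a" where
  "limZ w c g m = (THE z. \<forall>\<^sub>F N in sequentially. fst (apx N w c g m) = z)"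

definition limS :: "'w \<Rightarrow> (nat \<Rightarrow> real) \<Rightarrow> (nat \<Rightarrow> real) \<Rightarrow> nat \<Rightarrow> ennreal" where
  "limS w c g m = liminf (\<lambda>N. snd (apx N w c g m))"

lemma eventually_apx_eq_limZ_iff:
  "(\<forall>\<^sub>F N in sequentially. fst (apx N w c g m) = z) \<longleftrightarrow> limZ w c g m = z"
proof -
  obtain N0 where N0: "\<And>N. N0 \<le> N \<Longrightarrow> fst (apx (Suc N) w c g m) = fst (apx N w c g m)"
    using apx_eventually_mono by blast
  have "fst (apx N w c g m) = fst (apx N0 w c g m)" if "N0 \<le> N" for N
    using that by (induction N rule: dec_induct) (simp_all add: N0 del: apx.simps)
  then have ev: "\<forall>\<^sub>F N in sequentially. fst (apx N w c g m) = fst (apx N0 w c g m)"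
    unfolding eventually_sequentially by blast
  have unique: "z = z'" if "\<forall>\<^sub>F N in sequentially. fst (apx N w c g m) = z"
    "\<forall>\<^sub>F N in sequentially. fst (apx N w c g m) = z'" for z z'
  proof -
    have "\<forall>\<^sub>F N in sequentially. z = z'"
      using that by eventually_elim simp
    then show ?thesis by simp
  qed
  have "limZ w c g m = fst (apx N0 w c g m)"
    unfolding limZ_def by (rule the_equality, rule ev, rule unique[OF _ ev])
  then show ?thesis using ev unique by auto
qed

lemma
  shows apx_tendsto_limS: "(\<lambda>N. snd (apx N w c g m)) \<longlonglongrightarrow> limS w c g m"
    and eventually_apx_le_limS: "\<forall>\<^sub>F N in sequentially. snd (apx N w c g m) \<le> limS w c g m"
proof -
  obtain N0 where N0: "\<And>N. N0 \<le> N \<Longrightarrow> snd (apx N w c g m) \<le> snd (apx (Suc N) w c g m)"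
    using apx_eventually_mono by blast
  define a where "a i = snd (apx (i + N0) w c g m)" for i
  have "incseq a" unfolding a_def by (intro incseq_SucI) (use N0 in auto)
  then have "a \<longlonglongrightarrow> (SUP i. a i)" by (rule LIMSEQ_SUP)
  then have lim: "(\<lambda>N. snd (apx N w c g m)) \<longlonglongrightarrow> (SUP i. a i)"
    unfolding a_def by (rule LIMSEQ_offset)
  then have eq: "limS w c g m = (SUP i. a i)"
    unfolding limS_def by (intro lim_imp_Liminf) auto
  show "(\<lambda>N. snd (apx N w c g m)) \<longlonglongrightarrow> limS w c g m" unfolding eq by (rule lim)
  have "snd (apx N w c g m) \<le> limS w c g m" if "N0 \<le> N" for N
    unfolding eq using SUP_upper[of "N - N0" UNIV a] that by (simp add: a_def)
  then show "\<forall>\<^sub>F N in sequentially. snd (apx N w c g m) \<le> limS w c g m"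
    unfolding eventually_sequentially by blast
qed

lemma limZ_in: "w \<in> V \<Longrightarrow> limZ w c g m \<in> E"
proof -
  assume w: "w \<in> V"
  have "\<forall>\<^sub>F N in sequentially. fst (apx N w c g m) = limZ w c g m"
    by (simp add: eventually_apx_eq_limZ_iff)
  then obtain N where "fst (apx N w c g m) = limZ w c g m"
    by (auto simp: eventually_sequentially)
  then show ?thesis using apx_in(1)[OF w] by metis
qed

lemma apx_fst_measurable [measurable]:
  "(\<lambda>x. fst (apx N w (fst x) (snd x) m)) \<in> seq_space \<Otimes>\<^sub>M seq_space \<rightarrow>\<^sub>M count_space UNIV"
  by (rule measurable_compose[OF apx_measurable measurable_fst])

lemma apx_snd_measurable [measurable]:
  "(\<lambda>x. snd (apx N w (fst x) (snd x) m)) \<in> borel_measurable (seq_space \<Otimes>\<^sub>M seq_space)"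
  by (rule measurable_compose[OF apx_measurable measurable_snd])

lemma limZ_measurable [measurable]:
  "(\<lambda>x. limZ w (fst x) (snd x) m) \<in> seq_space \<Otimes>\<^sub>M seq_space \<rightarrow>\<^sub>M count_space UNIV"
proof (subst measurable_count_space_eq2_countable, safe)
  fix z
  have "(\<lambda>x. limZ w (fst x) (snd x) m) -` {z} \<inter> space (seq_space \<Otimes>\<^sub>M seq_space) =
    {x \<in> space (seq_space \<Otimes>\<^sub>M seq_space). \<exists>N. \<forall>n\<ge>N. fst (apx n w (fst x) (snd x) m) = z}"
    by (rule set_eqI)
      (simp add: conj_commute flip: eventually_sequentially add: eventually_apx_eq_limZ_iff)
  also have "\<dots> \<in> sets (seq_space \<Otimes>\<^sub>M seq_space)"
    by measurable
  finally show "(\<lambda>x. limZ w (fst x) (snd x) m) -` {z} \<inter> space (seq_space \<Otimes>\<^sub>M seq_space) \<in> sets (seq_space \<Otimes>\<^sub>M seq_space)" .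
qed auto

lemma limS_measurable [measurable]:
  "(\<lambda>x. limS w (fst x) (snd x) m) \<in> borel_measurable (seq_space \<Otimes>\<^sub>M seq_space)"
  unfolding limS_def by measurable

lemma eventually_traj_event_apx_iff:
  "\<forall>\<^sub>F N in sequentially. traj_event n z t (apx N w c g) \<longleftrightarrow>
      traj_event n z t (\<lambda>k. (limZ w c g k, limS w c g k))"
proof -
  have "\<forall>\<^sub>F N in sequentially. \<forall>k\<in>{..n}. (fst (apx N w c g k) = limZ w c g k) \<and>
      (ennreal (t k) < snd (apx N w c g k) \<longleftrightarrow> ennreal (t k) < limS w c g k)"
  proof (intro eventually_ball_finite ballI eventually_conj)
    fix k
    show "\<forall>\<^sub>F N in sequentially. fst (apx N w c g k) = limZ w c g k"
      by (simp add: eventually_apx_eq_limZ_iff)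
    show "\<forall>\<^sub>F N in sequentially. ennreal (t k) < snd (apx N w c g k) \<longleftrightarrow> ennreal (t k) < limS w c g k"
    proof (cases "ennreal (t k) < limS w c g k")
      case True
      then show ?thesis using order_tendstoD(1)[OF apx_tendsto_limS True] by simp
    next
      case False
      show ?thesis using eventually_apx_le_limS[of w c g k]
        by eventually_elim (use False in auto)
    qed
  qed simp
  then show ?thesis
  proof eventually_elim
    case (elim N)
    have "fst (apx N w c g k) = limZ w c g k" if "k \<le> n" for k
      using elim that by auto
    moreover have "ennreal (t k) < snd (apx N w c g k) \<longleftrightarrow> ennreal (t k) < limS w c g k" if "k < n" for k
      using elim that by auto
    ultimately show ?case by (auto simp: traj_event_def)
  qed
qed

lemma lim_law:
  assumes "w \<in> V" "\<And>k. k \<le> n \<Longrightarrow> z k \<in> E"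
  shows "measure (seq_space \<Otimes>\<^sub>M seq_space) {x \<in> space (seq_space \<Otimes>\<^sub>M seq_space).
      traj_event n z t (\<lambda>k. (limZ w (fst x) (snd x) k, limS w (fst x) (snd x) k))} =
    (if z 0 = f w then 1 else 0) * traj_prob q n z t"
proof -
  interpret seq: prob_space seq_space by (rule prob_space_seq_space)
  interpret seq2: pair_prob_space seq_space seq_space ..
  let ?M = "seq_space \<Otimes>\<^sub>M seq_space"
  let ?p = "(if z 0 = f w then 1 else 0) * traj_prob q n z t"
  let ?lim = "\<lambda>x. traj_event n z t (\<lambda>k. (limZ w (fst x) (snd x) k, limS w (fst x) (snd x) k))"
  have [measurable]: "Measurable.pred ?M (\<lambda>x. traj_event n z t (apx N w (fst x) (snd x)))" for N
    by (rule pred_traj_event) measurable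
  have [measurable]: "Measurable.pred ?M ?lim"
    by (rule pred_traj_event) measurable
  have "(\<lambda>N. \<integral>\<^sup>+x. indicator {x. traj_event n z t (apx N w (fst x) (snd x))} x \<partial>?M)
      \<longlonglongrightarrow> (\<integral>\<^sup>+x. indicator {x. ?lim x} x \<partial>?M)"
  proof (rule nn_integral_dominated_convergence[where w = "\<lambda>_. 1"])
    show "AE x in ?M. (\<lambda>N. indicator {x. traj_event n z t (apx N w (fst x) (snd x))} x :: ennreal)
        \<longlonglongrightarrow> indicator {x. ?lim x} x"
    proof (intro AE_I2 tendsto_eventually)
      fix x
      show "\<forall>\<^sub>F N in sequentially. (indicator {x. traj_event n z t (apx N w (fst x) (snd x))} x :: ennreal) = indicator {x. ?lim x} x"
        using eventually_traj_event_apx_iff[of n z t w "fst x" "snd x"]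
        by eventually_elim (simp add: indicator_def)
    qed
  qed (auto simp: seq2.emeasure_space_1 indicator_def)
  moreover have "(\<integral>\<^sup>+x. indicator {x. traj_event n z t (apx N w (fst x) (snd x))} x \<partial>?M) = ennreal ?p" for N
  proof -
    have "(\<integral>\<^sup>+x. indicator {x. traj_event n z t (apx N w (fst x) (snd x))} x \<partial>?M) =
      (\<integral>\<^sup>+c. \<integral>\<^sup>+g. indicator {x. traj_event n z t (apx N w (fst x) (snd x))} (c, g) \<partial>seq_space \<partial>seq_space)"
      by (rule seq.nn_integral_fst[symmetric]) measurable
    also have "\<dots> = ennreal ?p"
      using apx_law[OF assms] by (simp add: indicator_def)
    finally show ?thesis .
  qed
  ultimately have "(\<lambda>N. ennreal ?p) \<longlonglongrightarrow> (\<integral>\<^sup>+x. indicator {x. ?lim x} x \<partial>?M)" by simp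
  then have "(\<integral>\<^sup>+x. indicator {x. ?lim x} x \<partial>?M) = ennreal ?p"
    by (intro LIMSEQ_unique[OF _ tendsto_const])
  also have "(\<integral>\<^sup>+x. indicator {x. ?lim x} x \<partial>?M) = (\<integral>\<^sup>+x. indicator {x \<in> space ?M. ?lim x} x \<partial>?M)"
    by (intro nn_integral_cong) (auto simp: indicator_def)
  also have "\<dots> = emeasure ?M {x \<in> space ?M. ?lim x}"
    by (rule nn_integral_indicator) measurable
  finally show ?thesis
    using traj_prob_nonneg[OF assms(2)] by (simp add: measure_def)
qed

lemma sum_hold_time_Suc:
  "(\<Sum>i<Suc k. ennreal (hold_time F \<Lambda> w c i)) = ennreal (snd (F w (c 0)) / \<Lambda> w) +
     (\<Sum>i<k. ennreal (hold_time F \<Lambda> (fst (F w (c 0))) (\<lambda>n. c (Suc n)) i))"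
  by (simp only: sum.lessThan_Suc_shift) (simp add: hold_time_def)

lemma apx_tracks_walk:
  "\<exists>m a. a \<le> (\<Sum>i<k. ennreal (hold_time F \<Lambda> w c i)) \<and> (\<forall>N>k. (\<Sum>i<m. snd (apx N w c g i)) = a \<and>
     (\<Sum>i<Suc k. ennreal (hold_time F \<Lambda> w c i)) \<le> (\<Sum>i<Suc m. snd (apx N w c g i)) \<and>
     fst (apx N w c g m) = f (fst (walk F k w c)))"
proof (induction k arbitrary: w c)
  case 0
  have "(\<Sum>i<Suc 0. ennreal (hold_time F \<Lambda> w c i)) \<le> (\<Sum>i<Suc 0. snd (apx N w c g i))" if "0 < N" for N
    using that by (cases N) (auto simp: hold_time_def attach_def)
  then show ?case
    by (intro exI[of _ 0]) (auto simp: apx_start simp del: apx.simps)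
next
  case (Suc k)
  let ?w = "fst (F w (c 0))" and ?c = "\<lambda>n. c (Suc n)" and ?h = "ennreal (snd (F w (c 0)) / \<Lambda> w)"
  obtain m a where a: "a \<le> (\<Sum>i<k. ennreal (hold_time F \<Lambda> ?w ?c i))"
    and m: "\<And>N. k < N \<Longrightarrow> (\<Sum>i<m. snd (apx N ?w ?c g i)) = a"
      "\<And>N. k < N \<Longrightarrow> (\<Sum>i<Suc k. ennreal (hold_time F \<Lambda> ?w ?c i)) \<le> (\<Sum>i<Suc m. snd (apx N ?w ?c g i))"
      "\<And>N. k < N \<Longrightarrow> fst (apx N ?w ?c g m) = f (fst (walk F k ?w ?c))"
    using Suc[of ?w ?c] by blast
  have step: "apx (Suc N) w c g = attach (f w) (f ?w) ?h (apx N ?w ?c g)" for N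
    by simp
  have ha: "?h + a \<le> (\<Sum>i<Suc k. ennreal (hold_time F \<Lambda> w c i))"
    unfolding sum_hold_time_Suc using a by (intro add_left_mono)
  show ?case
  proof (cases "f w = f ?w")
    case True
    have up: "(\<Sum>i<Suc (Suc k). ennreal (hold_time F \<Lambda> w c i)) \<le> (\<Sum>i<Suc m. snd (apx (Suc N) w c g i))" if "k < N" for N
      unfolding step True sum_attach_same sum_hold_time_Suc[where k = "Suc k"] by (intro add_left_mono m(2) that)
    have st: "fst (apx (Suc N) w c g m) = f (fst (walk F (Suc k) w c))" if "k < N" for N
      unfolding step True using m(3)[OF that] by (auto simp: attach_def)
    have low: "(\<Sum>i<m. snd (apx (Suc N) w c g i)) = (if m = 0 then 0 else ?h + a)" if "k < N" for N
      unfolding step True using m(1)[OF that] by (cases m) (simp_all only: sum_attach_same, auto)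
    show ?thesis
    proof (intro exI[of _ m] exI[of _ "if m = 0 then 0 else ?h + a"] conjI allI impI)
      show "(if m = 0 then 0 else ?h + a) \<le> (\<Sum>i<Suc k. ennreal (hold_time F \<Lambda> w c i))" using ha by simp
      fix N assume "Suc k < N"
      then obtain N' where N: "N = Suc N'" "k < N'" by (cases N) auto
      show "(\<Sum>i<m. snd (apx N w c g i)) = (if m = 0 then 0 else ?h + a)"
        "(\<Sum>i<Suc (Suc k). ennreal (hold_time F \<Lambda> w c i)) \<le> (\<Sum>i<Suc m. snd (apx N w c g i))"
        "fst (apx N w c g m) = f (fst (walk F (Suc k) w c))"
        unfolding N(1) by (rule low up st, rule N(2))+
    qed
  next
    case False
    show ?thesis
    proof (intro exI[of _ "Suc m"] exI[of _ "?h + a"] conjI allI impI ha)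
      fix N assume "Suc k < N"
      then obtain N' where N: "N = Suc N'" "k < N'" by (cases N) auto
      show "(\<Sum>i<Suc m. snd (apx N w c g i)) = ?h + a"
        unfolding N(1) step sum_attach_diff[OF False] m(1)[OF N(2)] ..
      show "(\<Sum>i<Suc (Suc k). ennreal (hold_time F \<Lambda> w c i)) \<le> (\<Sum>i<Suc (Suc m). snd (apx N w c g i))"
        unfolding N(1) step sum_attach_diff[OF False] sum_hold_time_Suc[where k = "Suc k"]
        by (intro add_left_mono m(2) N(2))
      show "fst (apx N w c g (Suc m)) = f (fst (walk F (Suc k) w c))"
        unfolding N(1) step using m(3)[OF N(2)] False by (simp add: attach_def)
    qed
  qed
qed

lemma lim_path_eq_walk:
  assumes "(\<Sum>i<k. ennreal (hold_time F \<Lambda> w c i)) \<le> ennreal t" "ennreal t < (\<Sum>i<Suc k. ennreal (hold_time F \<Lambda> w c i))"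
  shows "jump_path x (limZ w c g) (limS w c g) t = f (fst (walk F k w c))"
proof -
  obtain m a where a: "a \<le> (\<Sum>i<k. ennreal (hold_time F \<Lambda> w c i))"
    and m: "\<And>N. k < N \<Longrightarrow> (\<Sum>i<m. snd (apx N w c g i)) = a"
      "\<And>N. k < N \<Longrightarrow> (\<Sum>i<Suc k. ennreal (hold_time F \<Lambda> w c i)) \<le> (\<Sum>i<Suc m. snd (apx N w c g i))"
      "\<And>N. k < N \<Longrightarrow> fst (apx N w c g m) = f (fst (walk F k w c))"
    using apx_tracks_walk[where k = k and w = w and c = c and g = g] by blast
  have ev: "\<forall>\<^sub>F N in sequentially. k < N" by (rule eventually_gt_at_top)
  have lim: "(\<lambda>N. \<Sum>i<j. snd (apx N w c g i)) \<longlonglongrightarrow> (\<Sum>i<j. limS w c g i)" for j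
    by (intro tendsto_sum apx_tendsto_limS)
  have "(\<lambda>N. \<Sum>i<m. snd (apx N w c g i)) \<longlonglongrightarrow> a"
    by (rule tendsto_eventually, rule eventually_mono[OF ev], rule m(1))
  then have "(\<Sum>i<m. limS w c g i) = a"
    using lim LIMSEQ_unique by blast
  moreover have "(\<Sum>i<Suc k. ennreal (hold_time F \<Lambda> w c i)) \<le> (\<Sum>i<Suc m. limS w c g i)"
    by (rule tendsto_lowerbound[OF lim], rule eventually_mono[OF ev], rule m(2)) simp_all
  ultimately have "jump_path x (limZ w c g) (limS w c g) t = limZ w c g m"
    using a assms by (intro jump_path_eq) auto
  moreover have "limZ w c g m = f (fst (walk F k w c))"
    unfolding eventually_apx_eq_limZ_iff[symmetric] by (rule eventually_mono[OF ev], rule m(3))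
  ultimately show ?thesis by simp
qed

text \<open>The fresh sequence \<open>snd (seq_split \<omega>)\<close> may be shared by several projections of the same chain,
  since only their individual laws matter after the explosion.\<close>

definition lumped_path :: "'w \<Rightarrow> real \<Rightarrow> (nat \<Rightarrow> real) \<Rightarrow> 'a" where
  "lumped_path w t \<omega> = jump_path (f w) (limZ w (fst (seq_split \<omega>)) (snd (seq_split \<omega>)))
     (limS w (fst (seq_split \<omega>)) (snd (seq_split \<omega>))) t"

theorem ctmc_lumped_path:
  assumes "w \<in> V"
  shows "ctmc seq_space E q (f w) (lumped_path w)"
  unfolding lumped_path_def
proof (rule ctmc_jump_path)
  fix n
  show "(\<lambda>\<omega>. limZ w (fst (seq_split \<omega>)) (snd (seq_split \<omega>)) n) \<in> seq_space \<rightarrow>\<^sub>M count_space UNIV"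
    by (rule measurable_compose[OF measurable_seq_split limZ_measurable])
  show "(\<lambda>\<omega>. limS w (fst (seq_split \<omega>)) (snd (seq_split \<omega>)) n) \<in> borel_measurable seq_space"
    by (rule measurable_compose[OF measurable_seq_split limS_measurable])
next
  fix n z and t :: "nat \<Rightarrow> real" assume z: "\<And>k::nat. k \<le> n \<Longrightarrow> z k \<in> E"
  let ?M = "seq_space \<Otimes>\<^sub>M seq_space"
  let ?A = "{x \<in> space ?M. traj_event n z t (\<lambda>k. (limZ w (fst x) (snd x) k, limS w (fst x) (snd x) k))}"
  have [measurable]: "Measurable.pred ?M (\<lambda>x. traj_event n z t (\<lambda>k. (limZ w (fst x) (snd x) k, limS w (fst x) (snd x) k)))"
    by (rule pred_traj_event) measurable
  have "measure ?M ?A = measure (distr seq_space ?M seq_split) ?A"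
    by (simp add: distr_seq_split)
  also have "\<dots> = measure seq_space (seq_split -` ?A \<inter> space seq_space)"
    by (rule measure_distr) measurable
  also have "seq_split -` ?A \<inter> space seq_space = {\<omega> \<in> space seq_space.
      traj_event n z t (\<lambda>k. (limZ w (fst (seq_split \<omega>)) (snd (seq_split \<omega>)) k, limS w (fst (seq_split \<omega>)) (snd (seq_split \<omega>)) k))}"
    using measurable_space[OF measurable_seq_split] by auto
  finally show "measure seq_space {\<omega> \<in> space seq_space.
      traj_event n z t (\<lambda>k. (limZ w (fst (seq_split \<omega>)) (snd (seq_split \<omega>)) k, limS w (fst (seq_split \<omega>)) (snd (seq_split \<omega>)) k))} =
      (if z 0 = f w then 1 else 0) * traj_prob q n z t"
    using lim_law[OF assms z] by simp
qed (use assms in \<open>auto simp: limZ_in f\<close>)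

end

section \<open>The coupling\<close>

lemma coupling_kernel_exists:
  fixes x y :: "'v :: {countable, ab_group_add}"
  assumes rates: "rate_matrix E qX" "rate_matrix E qY"
    and \<rho>: "\<rho> \<subseteq> E \<times> E" "(x, y) \<in> \<rho>"
    and a: "\<And>\<xi>. (x + \<xi>, y) \<notin> \<rho> \<Longrightarrow> qbar E qX x (x + \<xi>) \<le> qbar E qY y (y + \<xi>)"
    and b: "\<And>\<xi>. (x, y + \<xi>) \<notin> \<rho> \<Longrightarrow> qbar E qX x (x + \<xi>) \<ge> qbar E qY y (y + \<xi>)"
    and c: "\<And>\<xi>. (x + \<xi>, y + \<xi>) \<notin> \<rho> \<Longrightarrow> (x + \<xi>, y + \<xi>) \<notin> E \<times> E"
    and L: "hold_rate qX x + hold_rate qY y < L"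
  shows "\<exists>J. set_pmf J \<subseteq> \<rho> \<and>
    (\<forall>z\<in>E. z \<noteq> x \<longrightarrow> pmf (map_pmf fst J) z = qX x z / L) \<and>
    pmf (map_pmf fst J) x = 1 - hold_rate qX x / L \<and>
    (\<forall>z\<in>E. z \<noteq> y \<longrightarrow> pmf (map_pmf snd J) z = qY y z / L) \<and>
    pmf (map_pmf snd J) y = 1 - hold_rate qY y / L"
proof -
  have xy: "x \<in> E" "y \<in> E" using \<rho> by auto
  define rX where "rX \<xi> = (if \<xi> = 0 then 0 else qbar E qX x (x + \<xi>))" for \<xi>
  define rY where "rY \<xi> = (if \<xi> = 0 then 0 else qbar E qY y (y + \<xi>))" for \<xi>
  have shift: "(\<integral>\<^sup>+\<xi>. ennreal (if \<xi> = 0 then 0 else qbar E q u (u + \<xi>)) \<partial>count_space UNIV) = ennreal (hold_rate q u)"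
    if "rate_matrix E q" "u \<in> E" for q and u :: 'v
  proof -
    have "bij (\<lambda>\<xi>. u + \<xi>)"
      by (rule bij_betw_byWitness[where f' = "\<lambda>z. z - u"]) auto
    from nn_integral_bij_count_space[OF this, of "\<lambda>z. ennreal (if z = u then 0 else qbar E q u z)"]
    show ?thesis using nn_integral_offdiagonal_rates[OF that] by simp
  qed
  have nonneg: "0 \<le> (if \<xi> = 0 then 0 else qbar E q u (u + \<xi>))" if "rate_matrix E q" "u \<in> E" for q and u \<xi> :: 'v
    using that by (auto simp: qbar_def rate_matrix_def)
  have "\<exists>I :: ('v \<times> 'v) pmf.
    (\<forall>\<xi>. \<xi> \<noteq> 0 \<longrightarrow> pmf (map_pmf fst I) \<xi> = rX \<xi> / L) \<and> pmf (map_pmf fst I) 0 = 1 - hold_rate qX x / L \<and>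
    (\<forall>\<xi>. \<xi> \<noteq> 0 \<longrightarrow> pmf (map_pmf snd I) \<xi> = rY \<xi> / L) \<and> pmf (map_pmf snd I) 0 = 1 - hold_rate qY y / L \<and>
    (\<forall>\<xi> \<eta>. (\<xi>, \<eta>) \<in> set_pmf I \<longrightarrow> \<xi> = 0 \<and> \<eta> = 0 \<or> \<xi> = \<eta> \<and> 0 < rX \<xi> \<and> 0 < rY \<xi> \<or>
        \<eta> = 0 \<and> rY \<xi> < rX \<xi> \<or> \<xi> = 0 \<and> rX \<eta> < rY \<eta>)"
    unfolding rX_def rY_def
    by (rule coupled_increments_exist)
      (use rates xy L in \<open>simp_all add: shift hold_rate_nonneg nonneg del: if_split\<close>)
  then obtain I :: "('v \<times> 'v) pmf" where
    I: "\<And>\<xi>. \<xi> \<noteq> 0 \<Longrightarrow> pmf (map_pmf fst I) \<xi> = rX \<xi> / L" "pmf (map_pmf fst I) 0 = 1 - hold_rate qX x / L"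
      "\<And>\<xi>. \<xi> \<noteq> 0 \<Longrightarrow> pmf (map_pmf snd I) \<xi> = rY \<xi> / L" "pmf (map_pmf snd I) 0 = 1 - hold_rate qY y / L"
    and supp: "\<And>\<xi> \<eta>. (\<xi>, \<eta>) \<in> set_pmf I \<Longrightarrow> \<xi> = 0 \<and> \<eta> = 0 \<or> \<xi> = \<eta> \<and> 0 < rX \<xi> \<and> 0 < rY \<xi> \<or>
        \<eta> = 0 \<and> rY \<xi> < rX \<xi> \<or> \<xi> = 0 \<and> rX \<eta> < rY \<eta>"
    by (elim exE conjE) (rule that; iprover)
  define J where "J = map_pmf (\<lambda>(\<xi>, \<eta>). (x + \<xi>, y + \<eta>)) I"
  have translate: "pmf (map_pmf (\<lambda>\<xi>. u + \<xi>) p) z = pmf p (z - u)" for u z :: 'v and p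
    using pmf_map_inj'[of "\<lambda>\<xi>. u + \<xi>" p "z - u"] by simp
  have fst: "pmf (map_pmf fst J) z = pmf (map_pmf fst I) (z - x)" for z
    unfolding translate[symmetric] J_def pmf.map_comp by (simp add: comp_def split_beta')
  have snd: "pmf (map_pmf snd J) z = pmf (map_pmf snd I) (z - y)" for z
    unfolding translate[symmetric] J_def pmf.map_comp by (simp add: comp_def split_beta')
  have "(x + \<xi>, y + \<eta>) \<in> \<rho>" if "(\<xi>, \<eta>) \<in> set_pmf I" for \<xi> \<eta>
    using supp[OF that]
  proof (elim disjE conjE)
    assume "\<xi> = \<eta>" "0 < rX \<xi>" "0 < rY \<xi>"
    then have "x + \<xi> \<in> E" "y + \<xi> \<in> E" by (auto simp: rX_def rY_def qbar_def split: if_splits)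
    then show ?thesis using c[of \<xi>] \<open>\<xi> = \<eta>\<close> by auto
  next
    assume "\<eta> = 0" "rY \<xi> < rX \<xi>"
    then show ?thesis using a[of \<xi>] by (auto simp: rX_def rY_def split: if_splits)
  next
    assume "\<xi> = 0" "rX \<eta> < rY \<eta>"
    then show ?thesis using b[of \<eta>] by (auto simp: rX_def rY_def split: if_splits)
  qed (use \<rho> in simp)
  then have "set_pmf J \<subseteq> \<rho>" by (auto simp: J_def)
  then show ?thesis
    by (intro exI[of _ J]) (auto simp: fst snd I rX_def rY_def qbar_def)
qed

lemma explosion_time_le_suminf:
  fixes W :: "nat \<Rightarrow> 'a"
  assumes pos: "\<And>k. 0 < h k" and h: "summable h"
    and x: "\<And>k. x (\<Sum>i<k. h i) = W k" and inf: "infinite (range W)"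
  shows "explosion_time x \<le> ereal (suminf h)"
  unfolding explosion_time_def
proof (rule Inf_lower, rule CollectI, rule exI[of _ "suminf h"], intro conjI refl allI impI)
  show "0 \<le> suminf h" using pos h by (intro suminf_nonneg) (auto intro: less_imp_le)
  fix \<Gamma> :: "'a set" assume "finite \<Gamma>"
  then obtain k where "W k \<notin> \<Gamma>" using inf finite_subset[of "range W" \<Gamma>] by blast
  moreover have "(\<Sum>i<k. h i) < suminf h" using pos h by (intro sum_less_suminf)
  moreover have "0 \<le> (\<Sum>i<k. h i)" using pos by (intro sum_nonneg) (auto intro: less_imp_le)
  ultimately show "\<exists>s. 0 \<le> s \<and> s < suminf h \<and> x s \<notin> \<Gamma>" using x[of k] by auto
qed

lemma infinite_range_if_hold_times_summable:
  fixes e :: "nat \<Rightarrow> real"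
  assumes "\<not> summable e" "summable (\<lambda>k. e k / \<Lambda> (W k))" "\<And>k. 0 < e k" "\<And>k. 0 < \<Lambda> (W k)"
  shows "infinite (range W)"
proof
  assume fin: "finite (range W)"
  let ?B = "Max (\<Lambda> ` range W)"
  have "summable (\<lambda>k. ?B * (e k / \<Lambda> (W k)))" using assms(2) by (rule summable_mult)
  moreover have "norm (e k) \<le> ?B * (e k / \<Lambda> (W k))" for k
  proof -
    have "\<Lambda> (W k) * (e k / \<Lambda> (W k)) \<le> ?B * (e k / \<Lambda> (W k))"
      using fin assms(3,4)[of k] by (intro mult_right_mono Max_ge) auto
    then show ?thesis using assms(3,4)[of k] by simp
  qed
  ultimately have "summable e" by (rule summable_comparison_test'[where N = 0])
  then show False using assms(1) by simp
qed

theorem theorem3p1: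
  fixes E :: "(int ^ 'd) set"
    and qX qY :: "int ^ 'd \<Rightarrow> int ^ 'd \<Rightarrow> real"
    and \<rho> :: "((int ^ 'd) \<times> (int ^ 'd)) set"
    and x0 y0 :: "int ^ 'd"
  assumes "rate_matrix E qX" and "rate_matrix E qY"
    and "\<rho> \<subseteq> E \<times> E"
    and a: "\<And>x y \<xi>. (x, y) \<in> \<rho> \<Longrightarrow> (x + \<xi>, y) \<notin> \<rho> \<Longrightarrow>
              qbar E qX x (x + \<xi>) \<le> qbar E qY y (y + \<xi>)"
    and b: "\<And>x y \<xi>. (x, y) \<in> \<rho> \<Longrightarrow> (x, y + \<xi>) \<notin> \<rho> \<Longrightarrow>
              qbar E qX x (x + \<xi>) \<ge> qbar E qY y (y + \<xi>)"
    and c: "\<And>x y \<xi>. (x, y) \<in> \<rho> \<Longrightarrow> (x + \<xi>, y + \<xi>) \<notin> \<rho> \<Longrightarrow>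
              (x + \<xi>, y + \<xi>) \<notin> E \<times> E"
    and "(x0, y0) \<in> \<rho>"
  shows "\<exists>(M :: (nat \<Rightarrow> real) measure) X Y.
           prob_space M \<and> ctmc M E qX x0 X \<and> ctmc M E qY y0 Y \<and>
           (AE \<omega> in M. \<forall>t. 0 \<le> t \<longrightarrow>
              ereal t < min (explosion_time (\<lambda>s. X s \<omega>)) (explosion_time (\<lambda>s. Y s \<omega>)) \<longrightarrow>
              (X t \<omega>, Y t \<omega>) \<in> \<rho>)"
proof -
  define \<Lambda> where "\<Lambda> = (\<lambda>(x, y). hold_rate qX x + hold_rate qY y + 1)"
  have "\<forall>w. \<exists>J. w \<in> \<rho> \<longrightarrow> set_pmf J \<subseteq> \<rho> \<and>
    (\<forall>z\<in>E. z \<noteq> fst w \<longrightarrow> pmf (map_pmf fst J) z = qX (fst w) z / \<Lambda> w) \<and>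
    pmf (map_pmf fst J) (fst w) = 1 - hold_rate qX (fst w) / \<Lambda> w \<and>
    (\<forall>z\<in>E. z \<noteq> snd w \<longrightarrow> pmf (map_pmf snd J) z = qY (snd w) z / \<Lambda> w) \<and>
    pmf (map_pmf snd J) (snd w) = 1 - hold_rate qY (snd w) / \<Lambda> w"
  proof (clarify, simp only: fst_conv snd_conv)
    fix x y
    show "\<exists>J. (x, y) \<in> \<rho> \<longrightarrow> set_pmf J \<subseteq> \<rho> \<and>
      (\<forall>z\<in>E. z \<noteq> x \<longrightarrow> pmf (map_pmf fst J) z = qX x z / \<Lambda> (x, y)) \<and>
      pmf (map_pmf fst J) x = 1 - hold_rate qX x / \<Lambda> (x, y) \<and>
      (\<forall>z\<in>E. z \<noteq> y \<longrightarrow> pmf (map_pmf snd J) z = qY y z / \<Lambda> (x, y)) \<and>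
      pmf (map_pmf snd J) y = 1 - hold_rate qY y / \<Lambda> (x, y)"
    proof (cases "(x, y) \<in> \<rho>")
      case True
      then show ?thesis
        using coupling_kernel_exists[OF assms(1-3) True a[OF True] b[OF True] c[OF True], of "\<Lambda> (x, y)"]
        by (auto simp: \<Lambda>_def)
    qed simp
  qed
  then obtain J where J: "\<And>w. w \<in> \<rho> \<Longrightarrow> set_pmf (J w) \<subseteq> \<rho>"
      "\<And>w z. w \<in> \<rho> \<Longrightarrow> z \<in> E \<Longrightarrow> z \<noteq> fst w \<Longrightarrow> pmf (map_pmf fst (J w)) z = qX (fst w) z / \<Lambda> w"
      "\<And>w. w \<in> \<rho> \<Longrightarrow> pmf (map_pmf fst (J w)) (fst w) = 1 - hold_rate qX (fst w) / \<Lambda> w"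
      "\<And>w z. w \<in> \<rho> \<Longrightarrow> z \<in> E \<Longrightarrow> z \<noteq> snd w \<Longrightarrow> pmf (map_pmf snd (J w)) z = qY (snd w) z / \<Lambda> w"
      "\<And>w. w \<in> \<rho> \<Longrightarrow> pmf (map_pmf snd (J w)) (snd w) = 1 - hold_rate qY (snd w) / \<Lambda> w"
    unfolding choice_iff by blast
  have samplers: "\<exists>F. \<forall>u. step_sampler (p u) (F u)" for p :: "'u \<Rightarrow> 'v :: countable pmf"
    using step_sampler_exists by (intro choice) blast
  have jump_chain: "\<exists>P. \<forall>x\<in>E. set_pmf (P x) \<subseteq> E \<and> (\<forall>z\<in>E. pmf (P x) z = jump_prob q x z)"
    if "rate_matrix E q" for q
    using jump_chain_pmf_exists[OF that] by (intro bchoice) blast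
  obtain F where F: "\<And>w. step_sampler (J w) (F w)" using samplers by blast
  obtain PX where PX: "\<And>x. x \<in> E \<Longrightarrow> set_pmf (PX x) \<subseteq> E"
      "\<And>x z. x \<in> E \<Longrightarrow> z \<in> E \<Longrightarrow> pmf (PX x) z = jump_prob qX x z"
    using jump_chain[OF assms(1)] by blast
  obtain PY where PY: "\<And>x. x \<in> E \<Longrightarrow> set_pmf (PY x) \<subseteq> E"
      "\<And>x z. x \<in> E \<Longrightarrow> z \<in> E \<Longrightarrow> pmf (PY x) z = jump_prob qY x z"
    using jump_chain[OF assms(2)] by blast
  obtain GX where GX: "\<And>x. step_sampler (PX x) (GX x)" using samplers by blast
  obtain GY where GY: "\<And>x. step_sampler (PY x) (GY x)" using samplers by blast
  have in_E: "fst w \<in> E" "snd w \<in> E" if "w \<in> \<rho>" for w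
    using that assms(3) by auto
  have hold: "hold_rate qX (fst w) < \<Lambda> w" "hold_rate qY (snd w) < \<Lambda> w" if "w \<in> \<rho>" for w
    using hold_rate_nonneg[OF assms(1) in_E(1)[OF that]]
      hold_rate_nonneg[OF assms(2) in_E(2)[OF that]]
    by (simp_all add: \<Lambda>_def split_beta)
  interpret X: lumped_chain E qX \<rho> fst \<Lambda> J F PX GX
    by (rule lumped_chain.intro) (fact assms(1) F GX J in_E PX hold)+
  interpret Y: lumped_chain E qY \<rho> snd \<Lambda> J F PY GY
    by (rule lumped_chain.intro) (fact assms(2) F GY J in_E PY hold)+
  interpret seq: prob_space seq_space by (rule prob_space_seq_space)
  let ?w = "(x0, y0)"
  have "AE c in seq_space. \<not> summable (\<lambda>k. snd (walk F k ?w c))"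
    by (rule AE_waiting_times_not_summable[OF F])
  then have "AE c in distr (seq_space \<Otimes>\<^sub>M seq_space) seq_space fst. \<not> summable (\<lambda>k. snd (walk F k ?w c))"
    by (subst seq.distr_pair_fst)
  then have "AE x in seq_space \<Otimes>\<^sub>M seq_space. \<not> summable (\<lambda>k. snd (walk F k ?w (fst x)))"
    by (rule AE_distrD[rotated]) measurable
  then have "AE x in distr seq_space (seq_space \<Otimes>\<^sub>M seq_space) seq_split. \<not> summable (\<lambda>k. snd (walk F k ?w (fst x)))"
    by (simp only: distr_seq_split)
  then have "AE \<omega> in seq_space. \<not> summable (\<lambda>k. snd (walk F k ?w (fst (seq_split \<omega>))))"
    by (rule AE_distrD[rotated]) measurable
  then have "AE \<omega> in seq_space. \<forall>t. 0 \<le> t \<longrightarrow>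
      ereal t < min (explosion_time (\<lambda>s. X.lumped_path ?w s \<omega>)) (explosion_time (\<lambda>s. Y.lumped_path ?w s \<omega>)) \<longrightarrow>
      (X.lumped_path ?w t \<omega>, Y.lumped_path ?w t \<omega>) \<in> \<rho>"
  proof (eventually_elim, intro allI impI)
    fix \<omega> t
    assume ns: "\<not> summable (\<lambda>k. snd (walk F k ?w (fst (seq_split \<omega>))))" and t: "0 \<le> t"
      and less: "ereal t < min (explosion_time (\<lambda>s. X.lumped_path ?w s \<omega>)) (explosion_time (\<lambda>s. Y.lumped_path ?w s \<omega>))"
    let ?c = "fst (seq_split \<omega>)"
    let ?W = "\<lambda>k. fst (walk F k ?w ?c)" and ?h = "hold_time F \<Lambda> ?w ?c"
    have W: "?W k \<in> \<rho>" and e: "0 < snd (walk F k ?w ?c)" for k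
      using walk_in[OF F J(1) assms(7)] by auto
    have h: "0 < ?h k" for k
      using W e X.\<Lambda>_pos by (simp add: hold_time_def)
    have track: "X.lumped_path ?w s \<omega> = fst (?W k)" "Y.lumped_path ?w s \<omega> = snd (?W k)"
      if "(\<Sum>i<k. ?h i) \<le> s" "s < (\<Sum>i<Suc k. ?h i)" for k s
    proof -
      have nn: "0 \<le> ?h i" for i using h[of i] by simp
      have "0 < (\<Sum>i<Suc k. ?h i)" using h by (intro sum_pos) auto
      then have "(\<Sum>i<k. ennreal (?h i)) \<le> ennreal s" "ennreal s < (\<Sum>i<Suc k. ennreal (?h i))"
        using that by (simp_all only: sum_ennreal nn ennreal_leI ennreal_less_ennreal_pos)
      then show "X.lumped_path ?w s \<omega> = fst (?W k)" "Y.lumped_path ?w s \<omega> = snd (?W k)"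
        unfolding X.lumped_path_def Y.lumped_path_def by (rule X.lim_path_eq_walk Y.lim_path_eq_walk)+
    qed
    have "\<exists>k. t < (\<Sum>i<k. ?h i)"
    proof (rule ccontr)
      assume "\<nexists>k. t < (\<Sum>i<k. ?h i)"
      then have le: "(\<Sum>i<k. ?h i) \<le> t" for k by (simp add: not_less)
      have sm: "summable ?h"
        using h le by (intro summableI_nonneg_bounded) (auto intro: less_imp_le)
      have "infinite (range ?W)"
        using infinite_range_if_hold_times_summable[OF ns, of \<Lambda> ?W] sm e W X.\<Lambda>_pos
        by (simp add: hold_time_def[abs_def])
      moreover have sub: "range ?W \<subseteq> range (\<lambda>k. fst (?W k)) \<times> range (\<lambda>k. snd (?W k))"
        by (intro image_subsetI) (auto simp: mem_Times_iff)
      ultimately have "infinite (range (\<lambda>k. fst (?W k))) \<or> infinite (range (\<lambda>k. snd (?W k)))"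
        using finite_subset[OF sub] by (auto intro: finite_SigmaI)
      moreover have at_jump: "X.lumped_path ?w (\<Sum>i<k. ?h i) \<omega> = fst (?W k)"
        "Y.lumped_path ?w (\<Sum>i<k. ?h i) \<omega> = snd (?W k)" for k
        using h[of k] by (auto intro!: track)
      ultimately have "min (explosion_time (\<lambda>s. X.lumped_path ?w s \<omega>)) (explosion_time (\<lambda>s. Y.lumped_path ?w s \<omega>)) \<le> ereal (suminf ?h)"
        using explosion_time_le_suminf[where x = "\<lambda>s. X.lumped_path ?w s \<omega>", OF h sm at_jump(1)]
          explosion_time_le_suminf[where x = "\<lambda>s. Y.lumped_path ?w s \<omega>", OF h sm at_jump(2)]
        unfolding min_le_iff_disj by blast
      also have "ereal (suminf ?h) \<le> ereal t"
        using suminf_le_const[OF sm le] by simp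
      finally show False using less leD by blast
    qed
    then have L: "t < (\<Sum>i<(LEAST k. t < (\<Sum>i<k. ?h i)). ?h i)"
      by (rule LeastI_ex)
    then obtain k where k: "(LEAST k. t < (\<Sum>i<k. ?h i)) = Suc k"
      using t by (cases "LEAST k. t < (\<Sum>i<k. ?h i)") auto
    then have "(\<Sum>i<k. ?h i) \<le> t"
      using not_less_Least[of k "\<lambda>k. t < (\<Sum>i<k. ?h i)"] by simp
    then show "(X.lumped_path ?w t \<omega>, Y.lumped_path ?w t \<omega>) \<in> \<rho>"
      using track[of k t] L W[of k] unfolding k by simp
  qed
  then show ?thesis
    using X.ctmc_lumped_path[OF assms(7)] Y.ctmc_lumped_path[OF assms(7)] prob_space_seq_space
    by (intro exI[of _ seq_space] exI[of _ "X.lumped_path ?w"] exI[of _ "Y.lumped_path ?w"]) simp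
qed

end
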